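(* Let $d\ge1$ and $n\ge d+2$ be integers. For every regular $X\in\mathbb{R}^{d\times(n-1)}$, $$\big|\{\sigma\in\mathfrak S_n : 0\notin H(\sigma X)\}\big| = 2\sum_{r\ge0} c(n,d-2r).$$
   Context: $\mathfrak S_n$ is the group of permutations of $\{1,\dots,n\}$. For $X=(x_1|\dots|x_{n-1})\in\mathbb{R}^{d\times(n-1)}$ put $s_k(X)=x_1+\dots+x_k$ for $1\le k\le n-1$ and $H(X)=\operatorname{Conv}(s_1(X),\dots,s_{n-1}(X))$. The group $\mathfrak S_n$ acts on $\mathbb{R}^{d\times(n-1)}$ by restoring the last bridge increment, permuting columns, and deleting the last column: with $x_n:=-(x_1+\dots+x_{n-1})$, one sets $\sigma X=(x_{\sigma(1)}|\dots|x_{\sigma(n-1)})$. For $\sigma\in\mathfrak S_n$ and a $d$-element set $I\subseteq\{1,\dots,n-1\}$, the wall $D_{\sigma,I}$ is the set of $X\in\mathbb{R}^{d\times(n-1)}$ for which the vectors $s_i(\sigma X)$, $i\in I$, are linearly dependent. $X$ is called regular if it lies on no wall. The unsigned Stirling numbers of the first kind $c(n,k)$, $n\ge1$, $k\in\mathbb{Z}$, are defined by $\sum_{k\in\mathbb{Z}}c(n,k)x^k=x(x+1)\cdots(x+n-1)$; in particular $c(n,k)=0$ for $k\notin\{0,\dots,n\}$. *)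

theory Defs
  imports "HOL-Analysis.Analysis" "HOL-Combinatorics.Combinatorics"
begin

(* A real d x (n-1) matrix is represented by its columns X 1, ..., X (n - 1), where X has type
   nat => real ^ 'd with CARD('d) = d. The values of X at other indices are junk: none of the
   definitions below depends on them. *)

definition bridge_increments :: "nat \<Rightarrow> (nat \<Rightarrow> real ^ 'd) \<Rightarrow> nat \<Rightarrow> real ^ 'd" where
  "bridge_increments n X k = (if k = n then - (\<Sum>i\<in>{1..<n}. X i) else X k)"

(* For k in {1..<n} this is column k of the permuted matrix. *)
definition perm_act :: "nat \<Rightarrow> (nat \<Rightarrow> nat) \<Rightarrow> (nat \<Rightarrow> real ^ 'd) \<Rightarrow> nat \<Rightarrow> real ^ 'd" where
  "perm_act n \<sigma> X = (\<lambda>k. bridge_increments n X (\<sigma> k))"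

definition partial_sum :: "(nat \<Rightarrow> real ^ 'd) \<Rightarrow> nat \<Rightarrow> real ^ 'd" where
  "partial_sum X k = (\<Sum>i\<in>{1..k}. X i)"

definition walk_hull :: "nat \<Rightarrow> (nat \<Rightarrow> real ^ 'd) \<Rightarrow> (real ^ 'd) set" where
  "walk_hull n X = convex hull (partial_sum X ` {1..<n})"

(* Dependence of an indexed family. It differs from dependent (v ` I), which ignores repetitions:
   a family taking the same value at two indices is dependent here. *)
definition dependent_family :: "'i set \<Rightarrow> ('i \<Rightarrow> 'v::real_vector) \<Rightarrow> bool" where
  "dependent_family I v \<longleftrightarrow> (\<exists>c. (\<exists>i\<in>I. c i \<noteq> 0) \<and> (\<Sum>i\<in>I. c i *\<^sub>R v i) = 0)"

definition wall :: "nat \<Rightarrow> (nat \<Rightarrow> nat) \<Rightarrow> nat set \<Rightarrow> (nat \<Rightarrow> real ^ 'd) set" where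
  "wall n \<sigma> I = {X. dependent_family I (partial_sum (perm_act n \<sigma> X))}"

definition regular :: "nat \<Rightarrow> (nat \<Rightarrow> real ^ 'd) \<Rightarrow> bool" where
  "regular n X \<longleftrightarrow>
     (\<forall>\<sigma> I. \<sigma> permutes {1..n} \<and> I \<subseteq> {1..<n} \<and> card I = CARD('d) \<longrightarrow> X \<notin> wall n \<sigma> I)"

(* Unsigned Stirling numbers of the first kind, extended by zero to negative lower index. *)
definition stirling_int :: "nat \<Rightarrow> int \<Rightarrow> nat" where
  "stirling_int n k = (if k < 0 then 0 else stirling n (nat k))"

lemma stirling_int_eq_0: "k \<notin> {0..int n} \<Longrightarrow> stirling_int n k = 0"
  by (auto simp: stirling_int_def)

lemma stirling_int_generating_function:
  fixes x :: "'a::comm_semiring_1"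
  shows "(\<Sum>k\<in>{0..int n}. of_nat (stirling_int n k) * x ^ nat k) = (\<Prod>i<n. x + of_nat i)"
proof -
  have "(\<Sum>k\<in>{0..int n}. of_nat (stirling_int n k) * x ^ nat k)
      = (\<Sum>k\<le>n. of_nat (stirling n k) * x ^ k)"
    by (rule sum.reindex_bij_witness[where i = int and j = nat]) (auto simp: stirling_int_def)
  then show ?thesis
    by (simp add: stirling_pochhammer pochhammer_prod atLeast0LessThan)
qed

lemma suminf_stirling_int:
  "(\<Sum>r. stirling_int n (int d - 2 * int r)) = (\<Sum>r | 2 * r \<le> d. stirling n (d - 2 * r))"
proof -
  have "finite {r. 2 * r \<le> d}"
    by (rule finite_subset[of _ "{..d}"]) auto
  then have "(\<Sum>r. stirling_int n (int d - 2 * int r))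
      = (\<Sum>r | 2 * r \<le> d. stirling_int n (int d - 2 * int r))"
    by (rule suminf_finite) (auto simp: stirling_int_def)
  also have "\<dots> = (\<Sum>r | 2 * r \<le> d. stirling n (d - 2 * r))"
    by (rule sum.cong) (auto simp: stirling_int_def nat_diff_distrib nat_mult_distrib)
  finally show ?thesis .
qed

end

theory Submission
  imports Defs
begin

text \<open>The origin lies in \<open>H(\<sigma>X)\<close> iff some linear relation \<open>\<Sum> \<beta>\<^sub>i x\<^sub>i = 0\<close> has coefficients strictly
  decreasing along \<open>\<sigma>\<close>: Abel summation turns nonnegative coefficients of the \<open>s\<^sub>i\<close> into decreasing
  coefficients of the \<open>x\<^sub>i\<close>, and regularity allows the former to be perturbed to positive ones. So
  one has to count the orderings of \<open>{1..n}\<close> induced by a generic linear space of relations, that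
  is, the regions of the braid arrangement restricted to it. Adding one element \<open>z\<close>, an ordering
  of the others splits once for each \<open>i\<close> such that it persists on the hyperplane
  \<open>\<beta>\<^sub>i = \<beta>\<^sub>z\<close>. On this hyperplane \<open>x\<^sub>i\<close> and \<open>x\<^sub>z\<close> merge, while forgetting \<open>\<beta>\<^sub>z\<close> amounts to working
  modulo \<open>x\<^sub>z\<close>, which lowers the codimension \<open>k\<close> by one. Genericity survives both operations, so
  the count \<open>R\<close> satisfies \<open>R(n+1,k) = R(n,k-1) + n R(n,k)\<close>, and \<open>n! - R\<close> obeys the same
  recursion as \<open>2(c(n,k) + c(n,k-2) + \<dots>)\<close>.\<close>

subsection \<open>Orderings under deletion and restriction\<close>

definition order_on :: "'a set \<Rightarrow> ('a \<Rightarrow> real) \<Rightarrow> ('a \<times> 'a) set" where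
  "order_on A \<beta> = {(a, b). a \<in> A \<and> b \<in> A \<and> \<beta> a < \<beta> b}"

text \<open>For a linear space \<open>L\<close> these are its regions under the hyperplanes
  \<open>\<beta> a = \<beta> b\<close>, each encoded by the strict linear order common to its
  points. Only injectivity on \<open>A\<close> is asked, so members of \<open>L\<close> may carry
  further coordinates.\<close>

definition orders :: "'a set \<Rightarrow> ('a \<Rightarrow> real) set \<Rightarrow> ('a \<times> 'a) set set" where
  "orders A L = order_on A ` {\<beta> \<in> L. inj_on \<beta> A}"

lemma finite_orders: "finite A \<Longrightarrow> finite (orders A L)"
  by (rule finite_subset[of _ "Pow (A \<times> A)"]) (auto simp: orders_def order_on_def)

lemma order_on_cong: "(\<And>a. a \<in> A \<Longrightarrow> \<beta> a = \<gamma> a) \<Longrightarrow> order_on A \<beta> = order_on A \<gamma>"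
  by (auto simp: order_on_def)

text \<open>Finitely many strict inequalities persist for small \<open>\<epsilon>\<close> by
  continuity. Ties of \<open>\<beta>\<close> are left to \<open>\<gamma>\<close>, which is how they
  get broken later.\<close>

lemma strict_order_perturbation:
  fixes \<beta> \<gamma> :: "'a \<Rightarrow> real"
  assumes "finite A"
  shows "\<exists>\<epsilon>>0. \<forall>a\<in>A. \<forall>b\<in>A. \<beta> a < \<beta> b \<longrightarrow> \<beta> a + \<epsilon> * \<gamma> a < \<beta> b + \<epsilon> * \<gamma> b"
proof -
  have "eventually (\<lambda>\<epsilon>. \<beta> a < \<beta> b \<longrightarrow> \<beta> a + \<epsilon> * \<gamma> a < \<beta> b + \<epsilon> * \<gamma> b) (at_right 0)" for a b
  proof (cases "\<beta> a < \<beta> b")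
    case True
    have "((\<lambda>\<epsilon>. (\<beta> b + \<epsilon> * \<gamma> b) - (\<beta> a + \<epsilon> * \<gamma> a)) \<longlongrightarrow> (\<beta> b + 0 * \<gamma> b) - (\<beta> a + 0 * \<gamma> a)) (at_right 0)"
      by (intro tendsto_intros)
    then have "eventually (\<lambda>\<epsilon>. (\<beta> b + \<epsilon> * \<gamma> b) - (\<beta> a + \<epsilon> * \<gamma> a) > 0) (at_right 0)"
      by (rule order_tendstoD) (use True in auto)
    then show ?thesis by eventually_elim auto
  qed auto
  then have "eventually (\<lambda>\<epsilon>. \<forall>a\<in>A. \<forall>b\<in>A. \<beta> a < \<beta> b \<longrightarrow> \<beta> a + \<epsilon> * \<gamma> a < \<beta> b + \<epsilon> * \<gamma> b) (at_right 0)"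
    using assms by (intro eventually_ball_finite ballI) auto
  then have "eventually (\<lambda>\<epsilon>. 0 < \<epsilon> \<and> (\<forall>a\<in>A. \<forall>b\<in>A. \<beta> a < \<beta> b \<longrightarrow> \<beta> a + \<epsilon> * \<gamma> a < \<beta> b + \<epsilon> * \<gamma> b)) (at_right (0::real))"
    using eventually_at_right_less[of "0::real"] by eventually_elim auto
  then show ?thesis
    using eventually_happens' trivial_limit_at_right_real by blast
qed

section \<open>Inserting one element into an ordering\<close>

locale one_element_extension =
  fixes B :: "'a set" and z :: 'a and L :: "('a \<Rightarrow> real) set"
  assumes finite_B: "finite B" and z_notin_B: "z \<notin> B"
    and combination: "\<And>\<beta> \<gamma> s t. \<beta> \<in> L \<Longrightarrow> \<gamma> \<in> L \<Longrightarrow> (\<lambda>a. s * \<beta> a + t * \<gamma> a) \<in> L"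
    and separation: "\<And>i. i \<in> B \<Longrightarrow> \<exists>\<gamma>\<in>L. \<gamma> i \<noteq> \<gamma> z"
begin

text \<open>Once the ordering of \<open>B\<close> is fixed and \<open>z\<close> ties with no
  element, the elements below \<open>z\<close> determine the place of \<open>z\<close>.\<close>

definition cut :: "('a \<Rightarrow> real) \<Rightarrow> 'a set" where
  "cut \<beta> = {b \<in> B. \<beta> b < \<beta> z}"

definition cuts :: "('a \<times> 'a) set \<Rightarrow> 'a set set" where
  "cuts r = {cut \<beta> | \<beta>. \<beta> \<in> L \<and> inj_on \<beta> (insert z B) \<and> order_on B \<beta> = r}"

text \<open>At such an \<open>i\<close> the element \<open>z\<close> can be raised or lowered to the
  level of \<open>i\<close> while \<open>r\<close> is kept: \<open>r\<close> is still realized on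
  the hyperplane \<open>\<beta> i = \<beta> z\<close>.\<close>

definition collisions :: "('a \<times> 'a) set \<Rightarrow> 'a set" where
  "collisions r = {i \<in> B. \<exists>\<beta>\<in>L. inj_on \<beta> B \<and> order_on B \<beta> = r \<and> \<beta> i = \<beta> z}"

lemma inj_on_iff_order:
  assumes "order_on B \<beta> = order_on B \<gamma>" "inj_on \<beta> B"
  shows "inj_on \<gamma> B"
proof (rule inj_onI)
  fix a b assume *: "a \<in> B" "b \<in> B" "\<gamma> a = \<gamma> b"
  then have "(a, b) \<notin> order_on B \<beta>" "(b, a) \<notin> order_on B \<beta>"
    unfolding assms(1) by (auto simp: order_on_def)
  then have "\<beta> a = \<beta> b" using * by (auto simp: order_on_def)
  then show "a = b" using assms(2) * by (auto dest: inj_onD)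
qed

text \<open>Since \<open>\<beta>\<close> is injective on \<open>B\<close>, only \<open>i\<close>
  ties with \<open>z\<close>. A small multiple of \<open>\<gamma>\<close> keeps all strict
  inequalities and breaks this one tie the way \<open>\<gamma>\<close> orders \<open>i\<close> and
  \<open>z\<close>.\<close>

lemma perturbed:
  assumes \<beta>: "\<beta> \<in> L" "inj_on \<beta> B" "i \<in> B" "\<beta> i = \<beta> z"
    and \<gamma>: "\<gamma> \<in> L" "\<gamma> i \<noteq> \<gamma> z"
  shows "\<exists>\<beta>'\<in>L. inj_on \<beta>' (insert z B) \<and> order_on B \<beta>' = order_on B \<beta> \<and>
           cut \<beta>' = {b \<in> B. \<beta> b < \<beta> i \<or> b = i \<and> \<gamma> i < \<gamma> z}"
proof -
  obtain \<epsilon> where \<epsilon>: "\<epsilon> > 0"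
    "\<And>a b. a \<in> insert z B \<Longrightarrow> b \<in> insert z B \<Longrightarrow> \<beta> a < \<beta> b \<Longrightarrow> \<beta> a + \<epsilon> * \<gamma> a < \<beta> b + \<epsilon> * \<gamma> b"
    using strict_order_perturbation[of "insert z B" \<beta> \<gamma>] finite_B by auto
  define \<beta>' where "\<beta>' = (\<lambda>a. \<beta> a + \<epsilon> * \<gamma> a)"
  have L: "\<beta>' \<in> L"
    using combination[of \<beta> \<gamma> 1 \<epsilon>] \<beta> \<gamma> by (simp add: \<beta>'_def)
  have less: "\<beta>' a < \<beta>' b" if "a \<in> insert z B" "b \<in> insert z B" "\<beta> a < \<beta> b" for a b
    using \<epsilon>(2)[OF that] by (simp add: \<beta>'_def)
  have neq: "\<beta> a \<noteq> \<beta> b" if "a \<in> B" "b \<in> B" "a \<noteq> b" for a b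
    using that \<beta>(2) by (auto dest: inj_onD)
  have iff: "\<beta>' a < \<beta>' b \<longleftrightarrow> \<beta> a < \<beta> b" if "a \<in> B" "b \<in> B" for a b
    using less[of a b] less[of b a] neq[of a b] that by (cases "a = b") force+
  have order: "order_on B \<beta>' = order_on B \<beta>"
    by (auto simp: order_on_def iff)
  have i: "\<beta>' i < \<beta>' z \<longleftrightarrow> \<gamma> i < \<gamma> z" "\<beta>' i \<noteq> \<beta>' z"
    using \<epsilon>(1) \<beta>(4) \<gamma>(2) by (auto simp: \<beta>'_def)
  have z: "\<beta>' b < \<beta>' z \<longleftrightarrow> \<beta> b < \<beta> i" "\<beta>' b \<noteq> \<beta>' z" if "b \<in> B" "b \<noteq> i" for b
    using less[of b z] less[of z b] neq[of b i] that \<beta> by force+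
  have "cut \<beta>' = {b \<in> B. \<beta> b < \<beta> i \<or> b = i \<and> \<gamma> i < \<gamma> z}"
    unfolding cut_def using i z by force
  moreover have "inj_on \<beta>' (insert z B)"
  proof -
    have "inj_on \<beta>' B" using inj_on_iff_order[OF order[symmetric]] \<beta> by simp
    moreover have "\<beta>' z \<notin> \<beta>' ` B" using i z by force
    ultimately show ?thesis by (simp add: z_notin_B)
  qed
  ultimately show ?thesis using L order by blast
qed

text \<open>The tie between \<open>i\<close> and \<open>z\<close> is broken in both directions, by
  \<open>\<gamma>\<close> and by its negative, where \<open>\<gamma>\<close> exists because no
  hyperplane \<open>\<beta> i = \<beta> z\<close> contains \<open>L\<close>. So \<open>z\<close>
  lands just below and just above \<open>i\<close>.\<close>

lemma initial_segments_in_cuts: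
  assumes "i \<in> collisions r"
  shows "{b \<in> B. (b, i) \<in> r} \<in> cuts r" "{b \<in> B. (b, i) \<in> r \<or> b = i} \<in> cuts r"
proof -
  obtain \<beta> where \<beta>: "\<beta> \<in> L" "inj_on \<beta> B" "i \<in> B" "\<beta> i = \<beta> z" "order_on B \<beta> = r"
    using assms by (auto simp: collisions_def)
  obtain \<gamma> where \<gamma>: "\<gamma> \<in> L" "\<gamma> i \<noteq> \<gamma> z" using separation \<beta>(3) by blast
  have \<gamma>': "(\<lambda>a. - \<gamma> a) \<in> L" "- \<gamma> i \<noteq> - \<gamma> z"
    using combination[of \<gamma> \<gamma> "-1" 0] \<gamma> by auto
  have r: "(b, i) \<in> r \<longleftrightarrow> \<beta> b < \<beta> i" if "b \<in> B" for b
    using that \<beta>(3,5) by (auto simp: order_on_def)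
  have eq: "{b \<in> B. (b, i) \<in> r} = {b \<in> B. \<beta> b < \<beta> i}"
    "{b \<in> B. (b, i) \<in> r \<or> b = i} = {b \<in> B. \<beta> b < \<beta> i \<or> b = i}"
    using r by auto
  note p = perturbed[OF \<beta>(1-4) \<gamma>] perturbed[OF \<beta>(1-4) \<gamma>']
  have "{b \<in> B. \<beta> b < \<beta> i} \<in> cuts r \<and> {b \<in> B. \<beta> b < \<beta> i \<or> b = i} \<in> cuts r"
  proof (cases "\<gamma> i < \<gamma> z")
    case True
    then show ?thesis using p \<beta>(5) unfolding cuts_def by auto
  next
    case False
    then have "\<gamma> z < \<gamma> i" using \<gamma> by simp
    then show ?thesis using p \<beta>(5) unfolding cuts_def by auto
  qed
  then show "{b \<in> B. (b, i) \<in> r} \<in> cuts r" "{b \<in> B. (b, i) \<in> r \<or> b = i} \<in> cuts r"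
    unfolding eq by auto
qed

text \<open>A witness for \<open>r\<close> is injective on \<open>B\<close> only; if it ties
  \<open>z\<close> with some \<open>i\<close>, then \<open>i\<close> is a collision and the tie can
  be broken.\<close>

lemma cuts_nonempty:
  assumes "r \<in> orders B L"
  shows "cuts r \<noteq> {}"
proof -
  obtain \<beta> where \<beta>: "\<beta> \<in> L" "inj_on \<beta> B" "order_on B \<beta> = r"
    using assms by (auto simp: orders_def)
  show ?thesis
  proof (cases "\<exists>i\<in>B. \<beta> i = \<beta> z")
    case True
    then obtain i where "i \<in> collisions r" using \<beta> by (auto simp: collisions_def)
    then show ?thesis using initial_segments_in_cuts by blast
  next
    case False
    then have "\<beta> z \<notin> \<beta> ` B" by (metis imageE)
    then have "inj_on \<beta> (insert z B)" using \<beta> z_notin_B by simp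
    then show ?thesis using \<beta> by (auto simp: cuts_def)
  qed
qed

text \<open>A segment from a point with \<open>z\<close> below \<open>i\<close> to one with
  \<open>z\<close> above \<open>i\<close> meets the hyperplane of equality, and by convexity
  \<open>r\<close> is realized all along it.\<close>

lemma between_cuts_collision:
  assumes "D \<in> cuts r" "D' \<in> cuts r" "i \<in> D'" "i \<notin> D"
  shows "i \<in> collisions r"
proof -
  obtain \<beta> where \<beta>: "\<beta> \<in> L" "inj_on \<beta> (insert z B)" "order_on B \<beta> = r" "D = cut \<beta>"
    using assms by (auto simp: cuts_def)
  obtain \<gamma> where \<gamma>: "\<gamma> \<in> L" "inj_on \<gamma> (insert z B)" "order_on B \<gamma> = r" "D' = cut \<gamma>"
    using assms by (auto simp: cuts_def)
  have i: "i \<in> B" using assms \<gamma> by (auto simp: cut_def)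
  have "\<beta> i \<noteq> \<beta> z" using \<beta>(2) i z_notin_B by (metis inj_onD insertI1 insertI2)
  then have p: "\<beta> i - \<beta> z > 0" using assms(4) \<beta>(4) i by (auto simp: cut_def)
  have q: "\<gamma> z - \<gamma> i > 0" using assms(3) \<gamma>(4) by (auto simp: cut_def)
  \<comment> \<open>Positive weights chosen so that \<open>\<delta> i - \<delta> z\<close> cancels:
    the crossing point up to scaling.\<close>
  define \<delta> where "\<delta> = (\<lambda>a. (\<gamma> z - \<gamma> i) * \<beta> a + (\<beta> i - \<beta> z) * \<gamma> a)"
  have "\<delta> \<in> L" unfolding \<delta>_def using \<beta> \<gamma> combination by blast
  moreover have "\<delta> i = \<delta> z" by (simp add: \<delta>_def algebra_simps)
  moreover have iff: "\<beta> a < \<beta> b \<longleftrightarrow> \<gamma> a < \<gamma> b" if "a \<in> B" "b \<in> B" for a b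
  proof -
    have "(a, b) \<in> order_on B \<beta> \<longleftrightarrow> (a, b) \<in> order_on B \<gamma>" using \<beta> \<gamma> by simp
    then show ?thesis using that by (simp add: order_on_def)
  qed
  have lt: "\<delta> a < \<delta> b" if "a \<in> B" "b \<in> B" "\<beta> a < \<beta> b" for a b
    unfolding \<delta>_def using that iff p q by (intro add_strict_mono mult_strict_left_mono) auto
  have "order_on B \<delta> = order_on B \<beta>"
  proof -
    have "\<delta> a < \<delta> b \<longleftrightarrow> \<beta> a < \<beta> b" if "a \<in> B" "b \<in> B" for a b
    proof (cases "a = b")
      case False
      then have "\<beta> a \<noteq> \<beta> b" using that \<beta>(2) by (auto dest: inj_onD)
      then show ?thesis using lt[of a b] lt[of b a] that by force
    qed auto
    then show ?thesis by (auto simp: order_on_def)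
  qed
  moreover have "inj_on \<delta> B"
    using inj_on_iff_order[of \<beta> \<delta>] calculation \<beta>(2) by (auto simp: inj_on_subset)
  ultimately show ?thesis using i \<beta>(3) by (auto simp: collisions_def)
qed

text \<open>Ordered by inclusion, the cuts form a saturated chain of initial segments of \<open>r\<close>: each cut
  other than the least one is determined by its largest element, and these are the collisions.\<close>

lemma card_cuts:
  assumes r: "r \<in> orders B L"
  shows "card (cuts r) = Suc (card (collisions r))"
proof -
  obtain \<beta>0 where \<beta>0: "inj_on \<beta>0 B" "order_on B \<beta>0 = r"
    using r by (auto simp: orders_def)
  have r_iff: "(a, b) \<in> r \<longleftrightarrow> a \<in> B \<and> b \<in> B \<and> \<beta>0 a < \<beta>0 b" for a b
    using \<beta>0(2) by (auto simp: order_on_def)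
  have down: "a \<in> D" if "D \<in> cuts r" "b \<in> D" "(a, b) \<in> r" for D a b
    using that by (force simp: cuts_def cut_def order_on_def)
  have sub: "D \<subseteq> B" if "D \<in> cuts r" for D
    using that by (auto simp: cuts_def cut_def)
  have fin: "finite (cuts r)"
    by (rule finite_subset[of _ "Pow B"]) (use sub finite_B in auto)
  have chain: "D \<subseteq> D' \<or> D' \<subseteq> D" if "D \<in> cuts r" "D' \<in> cuts r" for D D'
  proof (rule ccontr)
    assume "\<not> ?thesis"
    then obtain a b where ab: "a \<in> D" "a \<notin> D'" "b \<in> D'" "b \<notin> D" by blast
    then have "a \<in> B" "b \<in> B" "a \<noteq> b" using sub that by auto
    then have "\<beta>0 a \<noteq> \<beta>0 b" using \<beta>0 by (auto dest: inj_onD)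
    then have "(a, b) \<in> r \<or> (b, a) \<in> r" using \<open>a \<in> B\<close> \<open>b \<in> B\<close> by (auto simp: r_iff)
    then show False using down ab that by blast
  qed
  obtain D0 where D0: "D0 \<in> cuts r" "\<And>D. D \<in> cuts r \<Longrightarrow> D \<subseteq> D0 \<Longrightarrow> D = D0"
    using finite_has_minimal[OF fin cuts_nonempty[OF r]] by metis
  have D0_le: "D0 \<subseteq> D" if "D \<in> cuts r" for D using chain D0 that by blast
  define seg where "seg i = {b \<in> B. (b, i) \<in> r \<or> b = i}" for i
  have inj: "inj_on seg (collisions r)"
  proof (rule inj_onI)
    fix i j assume *: "i \<in> collisions r" "j \<in> collisions r" "seg i = seg j"
    then have "i \<in> seg j" "j \<in> seg i" by (auto simp: seg_def collisions_def)
    then show "i = j" by (auto simp: seg_def r_iff)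
  qed
  have notin: "D0 \<notin> seg ` collisions r"
  proof
    assume "D0 \<in> seg ` collisions r"
    then obtain i where i: "i \<in> collisions r" "D0 = seg i" by auto
    have "i \<in> D0" using i by (auto simp: seg_def collisions_def)
    \<comment> \<open>The cut just below \<open>i\<close> omits \<open>i\<close>, yet the least cut
      \<open>D0\<close> would have to lie inside it.\<close>
    moreover have "D0 \<subseteq> {b \<in> B. (b, i) \<in> r}" using D0_le initial_segments_in_cuts(1) i by blast
    ultimately show False by (auto simp: r_iff)
  qed
  have "cuts r = insert D0 (seg ` collisions r)"
  proof (intro equalityI subsetI)
    fix D assume D: "D \<in> cuts r"
    show "D \<in> insert D0 (seg ` collisions r)"
    proof (cases "D = D0")
      case False
      then have "D \<noteq> {}" using D0_le D by auto
      moreover have finD: "finite D" using sub D finite_B finite_subset by blast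
      \<comment> \<open>The \<open>r\<close>-largest element of \<open>D\<close> is read off from
        the representative \<open>\<beta>0\<close>; as \<open>D\<close> is closed downwards, it is
        the segment ending there.\<close>
      ultimately have "Max (\<beta>0 ` D) \<in> \<beta>0 ` D" by (intro Max_in) auto
      then obtain i where i: "i \<in> D" "\<beta>0 i = Max (\<beta>0 ` D)" by force
      have le: "\<beta>0 b \<le> \<beta>0 i" if "b \<in> D" for b unfolding i(2) using that finD by simp
      have iB: "i \<in> B" using i sub D by auto
      have D_eq: "D = seg i"
      proof (intro equalityI subsetI)
        fix b assume b: "b \<in> D"
        then have "b \<in> B" using sub D by auto
        then show "b \<in> seg i" using le[OF b] iB \<beta>0(1)
          by (cases "\<beta>0 b = \<beta>0 i") (auto simp: seg_def r_iff dest: inj_onD)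
      qed (use i down[OF D] in \<open>auto simp: seg_def\<close>)
      have "i \<notin> D0"
      proof
        assume "i \<in> D0"
        then have "seg i \<subseteq> D0" using down[OF D0(1)] by (auto simp: seg_def)
        then show False using D_eq D0_le[OF D] False by auto
      qed
      then have "i \<in> collisions r" using between_cuts_collision[OF D0(1) D] i by blast
      then show ?thesis using D_eq by blast
    qed auto
  next
    fix D assume "D \<in> insert D0 (seg ` collisions r)"
    then show "D \<in> cuts r" using D0(1) initial_segments_in_cuts(2) unfolding seg_def by auto
  qed
  moreover have "finite (collisions r)"
    using finite_B by (simp add: collisions_def)
  ultimately show ?thesis
    using notin inj by (simp add: card_image)
qed

text \<open>An ordering of \<open>insert z B\<close> is an ordering \<open>r\<close> of
  \<open>B\<close> with one of its cuts, and \<open>r\<close> has one more cut than collisions.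
  Summing the collisions by element instead of by ordering gives the terms on the
  hyperplanes.\<close>

lemma card_orders_insert:
  "card (orders (insert z B) L) = card (orders B L) + (\<Sum>i\<in>B. card (orders B {\<beta> \<in> L. \<beta> i = \<beta> z}))"
proof -
  define h :: "('a \<times> 'a) set \<Rightarrow> ('a \<times> 'a) set \<times> 'a set"
    where "h q = (q \<inter> B \<times> B, {b \<in> B. (b, z) \<in> q})" for q
  have h: "h (order_on (insert z B) \<beta>) = (order_on B \<beta>, cut \<beta>)" for \<beta>
    by (auto simp: h_def order_on_def cut_def)
  have "inj_on h (orders (insert z B) L)"
  proof (rule inj_onI)
    fix q q' assume "q \<in> orders (insert z B) L" "q' \<in> orders (insert z B) L" and eq: "h q = h q'"
    then obtain \<beta> \<gamma> where q: "q = order_on (insert z B) \<beta>" "q' = order_on (insert z B) \<gamma>"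
      and inj: "inj_on \<beta> (insert z B)" "inj_on \<gamma> (insert z B)"
      by (auto simp: orders_def)
    have "order_on B \<beta> = order_on B \<gamma>" and cut: "cut \<beta> = cut \<gamma>" using eq by (auto simp: q h)
    then have BB: "\<beta> a < \<beta> b \<longleftrightarrow> \<gamma> a < \<gamma> b" if "a \<in> B" "b \<in> B" for a b
      using that unfolding order_on_def by blast
    have Bz: "\<beta> b < \<beta> z \<longleftrightarrow> \<gamma> b < \<gamma> z" if "b \<in> B" for b
      using that cut unfolding cut_def by blast
    have "\<beta> b \<noteq> \<beta> z" "\<gamma> b \<noteq> \<gamma> z" if "b \<in> B" for b
      using that inj z_notin_B by (metis inj_onD insertI1 insertI2)+
    then have zB: "\<beta> z < \<beta> b \<longleftrightarrow> \<gamma> z < \<gamma> b" if "b \<in> B" for b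
      using that Bz[OF that] by force
    show "q = q'" unfolding q order_on_def using BB Bz zB by auto
  qed
  moreover have "h ` orders (insert z B) L = (SIGMA r:orders B L. cuts r)"
  proof (intro equalityI subsetI)
    fix p assume "p \<in> h ` orders (insert z B) L"
    then show "p \<in> (SIGMA r:orders B L. cuts r)"
      by (auto simp: orders_def h cuts_def)
  next
    fix p assume "p \<in> (SIGMA r:orders B L. cuts r)"
    then obtain \<beta> where "\<beta> \<in> L" "inj_on \<beta> (insert z B)" "p = (order_on B \<beta>, cut \<beta>)"
      by (auto simp: cuts_def)
    then show "p \<in> h ` orders (insert z B) L"
      unfolding orders_def h[symmetric] by blast
  qed
  ultimately have "card (orders (insert z B) L) = card (SIGMA r:orders B L. cuts r)"
    by (metis card_image)
  also have "\<dots> = (\<Sum>r\<in>orders B L. card (cuts r))"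
  proof (rule card_SigmaI)
    have "cuts r \<subseteq> Pow B" for r by (auto simp: cuts_def cut_def)
    then show "\<forall>r\<in>orders B L. finite (cuts r)" using finite_B by (meson finite_Pow_iff finite_subset)
  qed (rule finite_orders[OF finite_B])
  also have "\<dots> = card (orders B L) + (\<Sum>r\<in>orders B L. card (collisions r))"
    by (simp add: card_cuts sum.distrib[symmetric] flip: Suc_eq_plus1_left) (simp add: sum_Suc)
  also have "(\<Sum>r\<in>orders B L. card (collisions r)) = card (SIGMA r:orders B L. collisions r)"
    by (rule card_SigmaI[symmetric]) (auto simp: finite_orders finite_B collisions_def)
  also have "(SIGMA r:orders B L. collisions r) = (SIGMA i:B. orders B {\<beta> \<in> L. \<beta> i = \<beta> z})\<inverse>"
    unfolding collisions_def orders_def by blast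
  also have "card \<dots> = card (SIGMA i:B. orders B {\<beta> \<in> L. \<beta> i = \<beta> z})"
    by (rule card_inverse)
  also have "\<dots> = (\<Sum>i\<in>B. card (orders B {\<beta> \<in> L. \<beta> i = \<beta> z}))"
    by (rule card_SigmaI) (auto simp: finite_orders finite_B)
  finally show ?thesis .
qed

end

subsection \<open>Generic spaces of relations\<close>

text \<open>For \<open>W = {0}\<close> these are the linear relations among the vectors
  \<open>x a\<close>; a larger \<open>W\<close> accounts for vectors already deleted.\<close>

definition relations_mod :: "'v::real_vector set \<Rightarrow> 'a set \<Rightarrow> ('a \<Rightarrow> 'v) \<Rightarrow> ('a \<Rightarrow> real) set" where
  "relations_mod W A x = {\<beta>. (\<Sum>a\<in>A. \<beta> a *\<^sub>R x a) \<in> W}"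

text \<open>For finite \<open>A\<close> the members are prefixes of a common ordering of
  \<open>A\<close>. The sets \<open>{}\<close> and \<open>A\<close> are excluded because their sums
  are \<open>0\<close> and, in the applications, an element of \<open>W\<close>.\<close>

definition proper_chain :: "'a set \<Rightarrow> 'a set set \<Rightarrow> bool" where
  "proper_chain A C \<longleftrightarrow> C \<subseteq> Pow A - {{}, A} \<and> (\<forall>S\<in>C. \<forall>T\<in>C. S \<subseteq> T \<or> T \<subseteq> S)"

text \<open>The sums of \<open>x\<close> over the members of any \<open>k\<close>-chain form a basis modulo \<open>W\<close>; thus \<open>k\<close> is
  the codimension of \<open>W\<close>. Allowing \<open>W \<noteq> 0\<close> keeps the class stable under deletion.\<close>

definition generic :: "'v::real_vector set \<Rightarrow> 'a set \<Rightarrow> ('a \<Rightarrow> 'v) \<Rightarrow> nat \<Rightarrow> bool" where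
  "generic W A x k \<longleftrightarrow> (\<forall>C. proper_chain A C \<and> card C = k \<longrightarrow>
     (\<forall>c. (\<Sum>S\<in>C. c S *\<^sub>R sum x S) \<in> W \<longrightarrow> (\<forall>S\<in>C. c S = 0)) \<and>
     (\<forall>v. \<exists>c. v - (\<Sum>S\<in>C. c S *\<^sub>R sum x S) \<in> W))"

section \<open>Relations and chains of subsets\<close>

lemma proper_chain_finite: "finite A \<Longrightarrow> proper_chain A C \<Longrightarrow> finite C"
  by (rule finite_subset[of _ "Pow A"]) (auto simp: proper_chain_def)

lemma relations_mod_combination:
  assumes "subspace W" "\<beta> \<in> relations_mod W A x" "\<gamma> \<in> relations_mod W A x"
  shows "(\<lambda>a. s * \<beta> a + t * \<gamma> a) \<in> relations_mod W A x"
proof -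
  have "(\<Sum>a\<in>A. (s * \<beta> a + t * \<gamma> a) *\<^sub>R x a)
      = s *\<^sub>R (\<Sum>a\<in>A. \<beta> a *\<^sub>R x a) + t *\<^sub>R (\<Sum>a\<in>A. \<gamma> a *\<^sub>R x a)"
    by (simp add: scaleR_sum_right sum.distrib scaleR_left_distrib)
  then show ?thesis
    using assms unfolding relations_mod_def by (auto intro!: subspace_add subspace_scale)
qed

lemma sum_indicator_combination:
  fixes x :: "'a \<Rightarrow> 'v::real_vector"
  assumes "finite A" "C \<subseteq> Pow A"
  shows "(\<Sum>a\<in>A. (\<Sum>S\<in>C. c S * of_bool (a \<in> S)) *\<^sub>R x a) = (\<Sum>S\<in>C. c S *\<^sub>R sum x S)"
proof -
  have "(\<Sum>a\<in>A. (\<Sum>S\<in>C. c S * of_bool (a \<in> S)) *\<^sub>R x a)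
      = (\<Sum>S\<in>C. \<Sum>a\<in>A. (c S * of_bool (a \<in> S)) *\<^sub>R x a)"
    by (simp add: scaleR_sum_left sum.swap[of _ A C])
  also have "\<dots> = (\<Sum>S\<in>C. c S *\<^sub>R sum x S)"
  proof (rule sum.cong[OF refl])
    fix S assume "S \<in> C"
    then have S: "S \<subseteq> A" using assms by auto
    have "(\<Sum>a\<in>A. (c S * of_bool (a \<in> S)) *\<^sub>R x a) = (\<Sum>a\<in>S. (c S * of_bool (a \<in> S)) *\<^sub>R x a)"
      by (rule sum.mono_neutral_right) (use assms S in auto)
    then show "(\<Sum>a\<in>A. (c S * of_bool (a \<in> S)) *\<^sub>R x a) = c S *\<^sub>R sum x S"
      by (simp add: scaleR_sum_right)
  qed
  finally show ?thesis .
qed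

text \<open>\<open>E\<close> itself is the smallest member and one element is added at a time; the
  size bound keeps all \<open>k\<close> members proper.\<close>

lemma chain_above_exists:
  assumes "finite A" "E \<subseteq> A" "E \<noteq> {}" "card E + k \<le> card A"
  shows "\<exists>C. proper_chain A C \<and> card C = k \<and> (\<forall>S\<in>C. E \<subseteq> S)"
  using assms
proof (induction k arbitrary: E)
  case 0
  then show ?case by (intro exI[of _ "{}"]) (auto simp: proper_chain_def)
next
  case (Suc k)
  have "E \<noteq> A" using Suc.prems by auto
  then obtain a where a: "a \<in> A" "a \<notin> E" using Suc.prems by auto
  have finE: "finite E" using Suc.prems finite_subset by auto
  have "\<exists>C. proper_chain A C \<and> card C = k \<and> (\<forall>S\<in>C. insert a E \<subseteq> S)"
    by (rule Suc.IH) (use Suc.prems a finE in auto)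
  then obtain C where C: "proper_chain A C" "card C = k" "\<And>S. S \<in> C \<Longrightarrow> insert a E \<subseteq> S" by auto
  have "E \<notin> C" using C(3) a by auto
  then have "card (insert E C) = Suc k" using C proper_chain_finite[OF Suc.prems(1) C(1)] by simp
  moreover have "proper_chain A (insert E C)"
    using C Suc.prems \<open>E \<noteq> A\<close> unfolding proper_chain_def by auto
  ultimately show ?case using C by (intro exI[of _ "insert E C"]) auto
qed

text \<open>There is room for a \<open>k\<close>-chain whose members all contain \<open>i\<close>
  and \<open>z\<close>. Expanding \<open>x i\<close> in its sums modulo \<open>W\<close> gives a
  relation whose chain part takes the same value at \<open>i\<close> and \<open>z\<close>, so
  \<open>\<beta> i - \<beta> z = 1\<close>.\<close>

lemma generic_separation:
  assumes "generic W A x k" "finite A" "i \<in> A" "z \<in> A" "i \<noteq> z" "Suc k < card A"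
  shows "\<exists>\<beta>\<in>relations_mod W A x. \<beta> i \<noteq> \<beta> z"
proof -
  have "\<exists>C. proper_chain A C \<and> card C = k \<and> (\<forall>S\<in>C. {i, z} \<subseteq> S)"
    by (rule chain_above_exists) (use assms in auto)
  then obtain C where C: "proper_chain A C" "card C = k" "\<And>S. S \<in> C \<Longrightarrow> {i, z} \<subseteq> S" by auto
  have sub: "C \<subseteq> Pow A" using C by (auto simp: proper_chain_def)
  obtain c where c: "x i - (\<Sum>S\<in>C. c S *\<^sub>R sum x S) \<in> W"
    using assms(1) C unfolding generic_def by blast
  define \<beta> where "\<beta> a = of_bool (a = i) - (\<Sum>S\<in>C. c S * of_bool (a \<in> S))" for a
  have "(\<Sum>a\<in>A. \<beta> a *\<^sub>R x a)
      = (\<Sum>a\<in>A. of_bool (a = i) *\<^sub>R x a) - (\<Sum>a\<in>A. (\<Sum>S\<in>C. c S * of_bool (a \<in> S)) *\<^sub>R x a)"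
    by (simp add: \<beta>_def scaleR_left_diff_distrib sum_subtractf)
  also have "(\<Sum>a\<in>A. of_bool (a = i) *\<^sub>R x a) = (\<Sum>a\<in>A. if a = i then x a else 0)"
    by (rule sum.cong) auto
  also have "\<dots> = x i"
    using assms by (simp add: sum.delta')
  also note sum_indicator_combination[OF assms(2) sub]
  finally have "\<beta> \<in> relations_mod W A x" using c by (simp add: relations_mod_def)
  moreover have "(\<Sum>S\<in>C. c S * of_bool (i \<in> S)) = (\<Sum>S\<in>C. c S * of_bool (z \<in> S))"
    using C(3) by (intro sum.cong) auto
  then have "\<beta> i - \<beta> z = 1" using assms(5) by (simp add: \<beta>_def)
  then have "\<beta> i \<noteq> \<beta> z" by linarith
  ultimately show ?thesis by blast
qed

text \<open>The indicators of a full flag, together with the constants, span all functions on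
  \<open>A\<close>. The flag comes from the order of insertion and need not sort
  \<open>\<beta>\<close>.\<close>

lemma chain_decomposition:
  fixes \<beta> :: "'a \<Rightarrow> real"
  assumes "finite A" "A \<noteq> {}"
  shows "\<exists>C c t. proper_chain A C \<and> Suc (card C) = card A \<and>
           (\<forall>a\<in>A. \<beta> a = t + (\<Sum>S\<in>C. c S * of_bool (a \<in> S)))"
  using assms
proof (induction A rule: finite_ne_induct)
  case (singleton a)
  show ?case by (intro exI[of _ "{}"] exI[of _ undefined] exI[of _ "\<beta> a"]) (auto simp: proper_chain_def)
next
  case (insert z A)
  then obtain C c t where C: "proper_chain A C" "Suc (card C) = card A"
    "\<And>a. a \<in> A \<Longrightarrow> \<beta> a = t + (\<Sum>S\<in>C. c S * of_bool (a \<in> S))" by blast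
  have sub: "C \<subseteq> Pow A" "A \<notin> C" using C by (auto simp: proper_chain_def)
  have fin: "finite C" using C insert proper_chain_finite by blast
  \<comment> \<open>The base value changes from \<open>t\<close> to \<open>\<beta> z\<close>; the
    new member \<open>A\<close> compensates for this on all old elements, and \<open>z\<close> lies
    in no member.\<close>
  define c' where "c' = c(A := t - \<beta> z)"
  have sum: "(\<Sum>S\<in>insert A C. c' S * of_bool (a \<in> S))
      = (t - \<beta> z) * of_bool (a \<in> A) + (\<Sum>S\<in>C. c S * of_bool (a \<in> S))" for a
  proof -
    have "(\<Sum>S\<in>C. c' S * of_bool (a \<in> S)) = (\<Sum>S\<in>C. c S * of_bool (a \<in> S))"
      using sub by (intro sum.cong) (auto simp: c'_def)
    then show ?thesis using fin sub by (simp add: c'_def)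
  qed
  have z: "(\<Sum>S\<in>C. c S * of_bool (z \<in> S)) = 0"
    using sub insert.hyps by (intro sum.neutral) auto
  have "\<beta> a = \<beta> z + (\<Sum>S\<in>insert A C. c' S * of_bool (a \<in> S))" if "a \<in> insert z A" for a
    unfolding sum using that z C(3) insert.hyps by (cases "a = z") auto
  moreover have "proper_chain (insert z A) (insert A C)"
    using C insert.hyps unfolding proper_chain_def by blast
  moreover have "Suc (card (insert A C)) = card (insert z A)"
    using C fin sub insert.hyps by simp
  ultimately show ?case by blast
qed

text \<open>In this codimension a full flag gives a basis modulo \<open>W\<close>. When a relation
  is decomposed along it, the constant part contributes an element of \<open>W\<close>, so the flag
  coefficients vanish and the relation is constant on \<open>A\<close>, which has at least two
  elements.\<close>

lemma generic_top_orders_empty: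
  assumes "generic W A x k" "finite A" "card A = Suc k" "k > 0" "subspace W" "sum x A \<in> W"
  shows "orders A (relations_mod W A x) = {}"
proof -
  have False if \<beta>: "\<beta> \<in> relations_mod W A x" "inj_on \<beta> A" for \<beta>
  proof -
    obtain C c t where C: "proper_chain A C" "Suc (card C) = card A"
      and eq: "\<And>a. a \<in> A \<Longrightarrow> \<beta> a = t + (\<Sum>S\<in>C. c S * of_bool (a \<in> S))"
      using chain_decomposition[of A \<beta>] assms(2,3) by fastforce
    have sub: "C \<subseteq> Pow A" using C by (auto simp: proper_chain_def)
    have "(\<Sum>a\<in>A. \<beta> a *\<^sub>R x a) = t *\<^sub>R sum x A + (\<Sum>a\<in>A. (\<Sum>S\<in>C. c S * of_bool (a \<in> S)) *\<^sub>R x a)"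
      by (simp add: eq scaleR_left_distrib sum.distrib scaleR_sum_right)
    also note sum_indicator_combination[OF assms(2) sub]
    finally have "t *\<^sub>R sum x A + (\<Sum>S\<in>C. c S *\<^sub>R sum x S) \<in> W"
      using \<beta> by (simp add: relations_mod_def)
    then have "(\<Sum>S\<in>C. c S *\<^sub>R sum x S) \<in> W"
      using subspace_diff[OF assms(5) _ subspace_scale[OF assms(5,6), of t]] by fastforce
    then have "c S = 0" if "S \<in> C" for S
      using assms(1,3) C that unfolding generic_def by auto
    then have const: "\<beta> a = t" if "a \<in> A" for a using eq[OF that] by simp
    have "card A \<le> 1"
      using const \<beta>(2) assms(2) by (auto simp: card_le_Suc0_iff_eq inj_on_def)
    then show False using assms by simp
  qed
  then show ?thesis by (auto simp: orders_def)
qed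

section \<open>Deletion and restriction of generic relation spaces\<close>

lemma orders_deletion:
  assumes "finite B" "z \<notin> B" "subspace W"
  shows "orders B (relations_mod W (insert z B) x) = orders B (relations_mod (span (insert (x z) W)) B x)"
proof (intro equalityI subsetI)
  fix r assume "r \<in> orders B (relations_mod W (insert z B) x)"
  then obtain \<beta> where \<beta>: "\<beta> \<in> relations_mod W (insert z B) x" "inj_on \<beta> B" "r = order_on B \<beta>"
    by (auto simp: orders_def)
  have "(\<Sum>a\<in>B. \<beta> a *\<^sub>R x a) - (- \<beta> z) *\<^sub>R x z \<in> span W"
    using \<beta>(1) assms by (auto simp: relations_mod_def add.commute intro: span_base)
  then have "\<beta> \<in> relations_mod (span (insert (x z) W)) B x"
    unfolding relations_mod_def span_insert by blast
  then show "r \<in> orders B (relations_mod (span (insert (x z) W)) B x)"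
    using \<beta> by (auto simp: orders_def)
next
  fix r assume "r \<in> orders B (relations_mod (span (insert (x z) W)) B x)"
  then obtain \<beta> k where \<beta>: "inj_on \<beta> B" "r = order_on B \<beta>"
    and k: "(\<Sum>a\<in>B. \<beta> a *\<^sub>R x a) - k *\<^sub>R x z \<in> W"
    using assms(3) by (auto simp: orders_def relations_mod_def span_insert span_eq_iff[THEN iffD2])
  \<comment> \<open>As \<open>z\<close> is outside \<open>B\<close>, its coefficient can be set to
    supply the term \<open>- k *\<^sub>R x z\<close> without affecting the ordering.\<close>
  define \<gamma> where "\<gamma> = \<beta>(z := - k)"
  have eq: "\<gamma> a = \<beta> a" if "a \<in> B" for a using that assms by (auto simp: \<gamma>_def)
  have "(\<Sum>a\<in>B. \<gamma> a *\<^sub>R x a) = (\<Sum>a\<in>B. \<beta> a *\<^sub>R x a)" by (simp add: eq)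
  then have "\<gamma> \<in> relations_mod W (insert z B) x"
    using k assms by (simp add: relations_mod_def \<gamma>_def)
  moreover have "inj_on \<gamma> B" using \<beta>(1) eq by (metis inj_on_cong)
  moreover have "r = order_on B \<gamma>" using \<beta>(2) eq order_on_cong by metis
  ultimately show "r \<in> orders B (relations_mod W (insert z B) x)" by (auto simp: orders_def)
qed

lemma sum_merged:
  fixes x :: "'a \<Rightarrow> 'v::real_vector"
  assumes "finite B" "z \<notin> B" "i \<in> B" "\<beta> i = \<beta> z"
  shows "(\<Sum>a\<in>insert z B. \<beta> a *\<^sub>R x a) = (\<Sum>a\<in>B. \<beta> a *\<^sub>R (x(i := x i + x z)) a)"
proof -
  have eq: "(\<Sum>a\<in>B - {i}. \<beta> a *\<^sub>R (x(i := x i + x z)) a) = (\<Sum>a\<in>B - {i}. \<beta> a *\<^sub>R x a)"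
    by (rule sum.cong) auto
  show ?thesis
    using assms by (simp add: sum.remove[OF assms(1,3)] eq scaleR_right_distrib del: fun_upd_apply)
      (simp add: scaleR_right_distrib)
qed

lemma orders_restriction:
  assumes "finite B" "z \<notin> B" "i \<in> B"
  shows "orders B {\<beta> \<in> relations_mod W (insert z B) x. \<beta> i = \<beta> z}
       = orders B (relations_mod W B (x(i := x i + x z)))"
proof (intro equalityI subsetI)
  fix r assume "r \<in> orders B {\<beta> \<in> relations_mod W (insert z B) x. \<beta> i = \<beta> z}"
  then show "r \<in> orders B (relations_mod W B (x(i := x i + x z)))"
    using sum_merged[OF assms, of _ x] by (auto simp: orders_def relations_mod_def simp del: fun_upd_apply)
next
  fix r assume "r \<in> orders B (relations_mod W B (x(i := x i + x z)))"
  then obtain \<beta> where \<beta>: "inj_on \<beta> B" "r = order_on B \<beta>" "\<beta> \<in> relations_mod W B (x(i := x i + x z))"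
    by (auto simp: orders_def)
  define \<gamma> where "\<gamma> = \<beta>(z := \<beta> i)"
  have \<gamma>: "\<gamma> i = \<gamma> z" using assms by (auto simp: \<gamma>_def)
  have eq: "\<gamma> a = \<beta> a" if "a \<in> B" for a using that assms by (auto simp: \<gamma>_def)
  have "(\<Sum>a\<in>B. \<gamma> a *\<^sub>R (x(i := x i + x z)) a) = (\<Sum>a\<in>B. \<beta> a *\<^sub>R (x(i := x i + x z)) a)"
    by (rule sum.cong) (simp_all add: eq)
  then have "\<gamma> \<in> relations_mod W (insert z B) x"
    using \<beta>(3) sum_merged[OF assms \<gamma>, of x] by (simp add: relations_mod_def)
  moreover have "inj_on \<gamma> B" using \<beta>(1) eq by (metis inj_on_cong)
  moreover have "r = order_on B \<gamma>" using \<beta>(2) eq order_on_cong by metis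
  ultimately show "r \<in> orders B {\<beta> \<in> relations_mod W (insert z B) x. \<beta> i = \<beta> z}"
    using \<gamma> by (auto simp: orders_def)
qed

text \<open>Only the empty chain has \<open>0\<close> members; finiteness of \<open>A\<close> rules
  out infinite chains, whose \<open>card\<close> is also \<open>0\<close>.\<close>

lemma generic_0_iff:
  assumes "finite A"
  shows "generic W A x 0 \<longleftrightarrow> W = UNIV"
proof -
  have "proper_chain A C \<and> card C = 0 \<longleftrightarrow> C = {}" for C
    using proper_chain_finite[OF assms, of C] by (auto simp: proper_chain_def)
  then have "generic W A x 0 \<longleftrightarrow> (\<forall>v. v \<in> W)" by (simp add: generic_def)
  then show ?thesis by blast
qed

text \<open>A chain in \<open>B\<close> is extended by the member \<open>B\<close>. Since the total
  sum lies in \<open>W\<close>, \<open>sum x B\<close> equals \<open>- x z\<close> modulo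
  \<open>W\<close>, so the new member supplies exactly the direction that is added to
  \<open>W\<close>.\<close>

lemma generic_deletion:
  assumes gen: "generic W (insert z B) x (Suc k)" and B: "finite B" "B \<noteq> {}" "z \<notin> B"
    and W: "subspace W" "sum x (insert z B) \<in> W"
  shows "generic (span (insert (x z) W)) B x k"
  unfolding generic_def
proof (intro allI impI conjI, goal_cases)
  case (1 C c)
  then have C: "proper_chain B C" "card C = k" by auto
  have sub: "C \<subseteq> Pow B" "B \<notin> C" "finite C" using C B proper_chain_finite by (auto simp: proper_chain_def)
  have C': "proper_chain (insert z B) (insert B C)" "card (insert B C) = Suc k"
    using C B sub by (auto simp: proper_chain_def)
  obtain t where t: "(\<Sum>S\<in>C. c S *\<^sub>R sum x S) - t *\<^sub>R x z \<in> W"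
    using 1 W by (auto simp: span_insert span_eq_iff[THEN iffD2])
  define c' where "c' = c(B := t)"
  have "(\<Sum>S\<in>C. c' S *\<^sub>R sum x S) = (\<Sum>S\<in>C. c S *\<^sub>R sum x S)"
    using sub by (intro sum.cong) (auto simp: c'_def)
  then have "(\<Sum>S\<in>insert B C. c' S *\<^sub>R sum x S)
      = ((\<Sum>S\<in>C. c S *\<^sub>R sum x S) - t *\<^sub>R x z) + t *\<^sub>R sum x (insert z B)"
    using sub B by (simp add: c'_def scaleR_right_distrib)
  then have "(\<Sum>S\<in>insert B C. c' S *\<^sub>R sum x S) \<in> W"
    using t W by (auto intro!: subspace_add subspace_scale)
  then have "\<forall>S\<in>insert B C. c' S = 0" using gen C' unfolding generic_def by blast
  then show ?case using sub(2) by (metis c'_def fun_upd_other insertCI)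
next
  case (2 C v)
  then have C: "proper_chain B C" "card C = k" by auto
  have sub: "C \<subseteq> Pow B" "B \<notin> C" "finite C" using C B proper_chain_finite by (auto simp: proper_chain_def)
  have C': "proper_chain (insert z B) (insert B C)" "card (insert B C) = Suc k"
    using C B sub by (auto simp: proper_chain_def)
  obtain c where c: "v - (\<Sum>S\<in>insert B C. c S *\<^sub>R sum x S) \<in> W"
    using gen C' unfolding generic_def by blast
  have "(v - (\<Sum>S\<in>insert B C. c S *\<^sub>R sum x S)) + c B *\<^sub>R sum x (insert z B) \<in> W"
    using c W by (auto intro!: subspace_add subspace_scale)
  also have "(v - (\<Sum>S\<in>insert B C. c S *\<^sub>R sum x S)) + c B *\<^sub>R sum x (insert z B)
     = (v - (\<Sum>S\<in>C. c S *\<^sub>R sum x S)) - (- c B) *\<^sub>R x z"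
    using sub B by (simp add: algebra_simps)
  finally show ?case
    using W(1) unfolding span_insert by (metis (mono_tags, lifting) mem_Collect_eq span_base)
qed

text \<open>Chains of the merged family lift to chains of the original one with the same sums, so
  the basis property is inherited with the same \<open>k\<close>.\<close>

lemma generic_restriction:
  assumes gen: "generic W (insert z B) x k" and B: "finite B" "z \<notin> B" "i \<in> B"
  shows "generic W B (x(i := x i + x z)) k"
proof -
  \<comment> \<open>\<open>z\<close> accompanies \<open>i\<close>; removing \<open>z\<close>
    recovers \<open>S\<close>, which carries coefficients between a chain and its lift.\<close>
  define \<phi> where "\<phi> S = (if i \<in> S then insert z S else S)" for S
  have \<phi>: "\<phi> S - {z} = S" if "S \<subseteq> B" for S using that B by (auto simp: \<phi>_def)
  have sum: "sum x (\<phi> S) = sum (x(i := x i + x z)) S" if S: "S \<subseteq> B" for S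
  proof (cases "i \<in> S")
    case True
    moreover have "finite S" "z \<notin> S" using S B finite_subset by auto
    ultimately show ?thesis
      using sum_merged[of S z i "\<lambda>_. 1" x] by (simp add: \<phi>_def del: fun_upd_apply)
  next
    case False
    then show ?thesis by (auto simp: \<phi>_def intro!: sum.cong)
  qed
  have reindex: "(\<Sum>S\<in>\<phi> ` C. c (S - {z}) *\<^sub>R sum x S) = (\<Sum>S\<in>C. c S *\<^sub>R sum (x(i := x i + x z)) S)"
    and chain: "proper_chain (insert z B) (\<phi> ` C)" "card (\<phi> ` C) = card C"
    if "proper_chain B C" for C c
  proof -
    have sub: "C \<subseteq> Pow B" using that by (auto simp: proper_chain_def)
    have inj: "inj_on \<phi> C" by (rule inj_on_inverseI[where g = "\<lambda>S. S - {z}"]) (use \<phi> sub in auto)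
    show "card (\<phi> ` C) = card C" using inj by (rule card_image)
    show "(\<Sum>S\<in>\<phi> ` C. c (S - {z}) *\<^sub>R sum x S) = (\<Sum>S\<in>C. c S *\<^sub>R sum (x(i := x i + x z)) S)"
      unfolding sum.reindex[OF inj] o_def by (intro sum.cong refl) (use sum \<phi> sub in auto)
    have mem: "\<phi> S \<subseteq> insert z B \<and> \<phi> S \<noteq> {} \<and> \<phi> S \<noteq> insert z B" if "S \<in> C" for S
    proof -
      have S: "S \<subseteq> B" "S \<noteq> {}" "S \<noteq> B" using that \<open>proper_chain B C\<close> by (auto simp: proper_chain_def)
      have "\<phi> S \<noteq> insert z B" using \<phi>[OF S(1)] S(3) B by auto
      then show ?thesis using S by (auto simp: \<phi>_def)
    qed
    have mono: "\<phi> S \<subseteq> \<phi> T" if "S \<subseteq> T" for S T using that by (auto simp: \<phi>_def)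
    show "proper_chain (insert z B) (\<phi> ` C)"
      unfolding proper_chain_def
    proof (intro conjI)
      show "\<phi> ` C \<subseteq> Pow (insert z B) - {{}, insert z B}" using mem by auto
      have "S \<subseteq> T \<or> T \<subseteq> S" if "S \<in> C" "T \<in> C" for S T
        using that \<open>proper_chain B C\<close> by (auto simp: proper_chain_def)
      then show "\<forall>S\<in>\<phi> ` C. \<forall>T\<in>\<phi> ` C. S \<subseteq> T \<or> T \<subseteq> S" using mono by (metis imageE)
    qed
  qed
  show ?thesis
    unfolding generic_def
  proof (intro allI impI conjI, goal_cases)
    case (1 C c)
    then have "(\<Sum>S\<in>\<phi> ` C. c (S - {z}) *\<^sub>R sum x S) \<in> W" using reindex[of C c] by simp
    moreover have "proper_chain (insert z B) (\<phi> ` C)" "card (\<phi> ` C) = k"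
      using chain[of C] 1 by auto
    ultimately have "\<forall>S\<in>\<phi> ` C. c (S - {z}) = 0"
      using gen[unfolded generic_def, rule_format, THEN conjunct1, rule_format, of "\<phi> ` C" "\<lambda>S. c (S - {z})"]
      by blast
    then have "c (\<phi> S - {z}) = 0" if "S \<in> C" for S using that by blast
    moreover have "\<phi> S - {z} = S" if "S \<in> C" for S
      using that 1 \<phi> by (auto simp: proper_chain_def)
    ultimately show ?case by simp
  next
    case (2 C v)
    then have "proper_chain (insert z B) (\<phi> ` C)" "card (\<phi> ` C) = k"
      using chain[of C] by auto
    then obtain c where c: "v - (\<Sum>S\<in>\<phi> ` C. c S *\<^sub>R sum x S) \<in> W"
      using gen unfolding generic_def by blast
    have sub: "C \<subseteq> Pow B" using 2 by (auto simp: proper_chain_def)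
    have "(\<Sum>S\<in>\<phi> ` C. c S *\<^sub>R sum x S) = (\<Sum>S\<in>\<phi> ` C. (\<lambda>S. c (\<phi> S)) (S - {z}) *\<^sub>R sum x S)"
      using \<phi> sub by (intro sum.cong refl) auto
    also have "\<dots> = (\<Sum>S\<in>C. c (\<phi> S) *\<^sub>R sum (x(i := x i + x z)) S)"
      using reindex[of C "\<lambda>S. c (\<phi> S)"] 2 by simp
    finally show ?case using c by (intro exI[of _ "\<lambda>S. c (\<phi> S)"]) simp
  qed
qed

section \<open>Sums of Stirling numbers of one parity, and the count of orderings\<close>

fun stirling_alternate_sum :: "nat \<Rightarrow> nat \<Rightarrow> nat" where
  "stirling_alternate_sum n 0 = stirling n 0"
| "stirling_alternate_sum n (Suc 0) = stirling n 1"
| "stirling_alternate_sum n (Suc (Suc k)) = stirling n (Suc (Suc k)) + stirling_alternate_sum n k"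

lemma stirling_alternate_sum_0: "n > 0 \<Longrightarrow> stirling_alternate_sum n 0 = 0"
  by (cases n) auto

text \<open>The recurrence c(n+1,j) = n c(n,j) + c(n,j-1) is linear, so it passes to sums over every
  second index; at the bottom c(n,0) = 0.\<close>

lemma stirling_alternate_sum_Suc:
  assumes "n > 0"
  shows "stirling_alternate_sum (Suc n) (Suc k)
       = n * stirling_alternate_sum n (Suc k) + stirling_alternate_sum n k"
  using assms
proof (induction n k rule: stirling_alternate_sum.induct)
  case (1 n)
  then show ?case by (simp add: algebra_simps)
next
  case (2 n)
  then have "stirling n 0 = 0" by (cases n) auto
  then show ?case by (simp add: algebra_simps numeral_2_eq_2)
next
  case (3 n k)
  then show ?case by (simp add: algebra_simps)
qed

text \<open>For such \<open>k\<close> the sum contains every nonzero c(n,j) with j of the parity of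
  \<open>k\<close>, and the two parity classes have equal sums because x(x+1)...(x+n-1) vanishes at
  -1. The proof uses the recurrence instead: both sums that it yields are again in this
  range.\<close>

lemma twice_stirling_alternate_sum_top:
  assumes "2 \<le> n" "n \<le> Suc k"
  shows "2 * stirling_alternate_sum n k = fact n"
  using assms
proof (induction n arbitrary: k rule: dec_induct)
  case base
  have "stirling_alternate_sum 2 (Suc k) = 1" for k
    by (induction "2::nat" k rule: stirling_alternate_sum.induct) (auto simp: numeral_2_eq_2)
  then show ?case using base by (cases k) (auto simp: numeral_2_eq_2)
next
  case (step n)
  then obtain l where l: "k = Suc l" by (cases k) auto
  have "2 * stirling_alternate_sum (Suc n) k
      = n * (2 * stirling_alternate_sum n (Suc l)) + 2 * stirling_alternate_sum n l"
    unfolding l using step by (simp add: stirling_alternate_sum_Suc)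
  also have "\<dots> = fact (Suc n)"
    using step l by simp
  finally show ?case .
qed

lemma suminf_stirling_int_eq: "(\<Sum>r. stirling_int n (int k - 2 * int r)) = stirling_alternate_sum n k"
proof -
  have "(\<Sum>r | 2 * r \<le> k. stirling n (k - 2 * r)) = stirling_alternate_sum n k"
  proof (induction n k rule: stirling_alternate_sum.induct)
    case (3 n k)
    have "{r. 2 * r \<le> Suc (Suc k)} = insert 0 (Suc ` {r. 2 * r \<le> k})"
      using not0_implies_Suc by (fastforce simp: image_iff)
    moreover have "finite {r. 2 * r \<le> k}" by (rule finite_subset[of _ "{..k}"]) auto
    ultimately show ?case using 3 by (simp add: sum.reindex)
  next
    case (2 n)
    have "{r. 2 * r \<le> Suc 0} = {0}" by auto
    then show ?case by simp
  qed auto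
  then show ?thesis by (simp add: suminf_stirling_int)
qed

text \<open>Induction on \<open>A\<close> with everything else free: deletion changes
  \<open>W\<close> and \<open>k\<close>, restriction changes \<open>x\<close>, and both preserve
  genericity and the membership of the total sum in \<open>W\<close>. In the top codimension there
  are no orderings; below it \<open>generic_separation\<close> applies, and the count follows by
  deletion and restriction.\<close>

lemma card_orders_generic:
  fixes x :: "'a \<Rightarrow> 'v::real_vector"
  assumes "finite A" "A \<noteq> {}" "subspace W" "sum x A \<in> W" "generic W A x k" "k < card A"
  shows "card (orders A (relations_mod W A x)) + 2 * stirling_alternate_sum (card A) k = fact (card A)"
  using assms
proof (induction A arbitrary: W x k rule: finite_ne_induct)
  case (singleton a)
  then have [simp]: "k = 0" by simp
  have "(\<lambda>_. 0) \<in> relations_mod W {a} x"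
    using singleton by (auto simp: relations_mod_def subspace_0)
  then have "orders {a} (relations_mod W {a} x) = {{}}"
    by (auto simp: orders_def order_on_def)
  then show ?case by simp
next
  case (insert z B)
  note W = \<open>subspace W\<close>
  let ?n = "card B" and ?A = "insert z B"
  have n: "?n > 0" "card ?A = Suc ?n" using insert.hyps by (auto simp: card_gt_0_iff)
  show ?case
  proof (cases "k = ?n")
    case True
    then have "orders ?A (relations_mod W ?A x) = {}"
      using insert n by (intro generic_top_orders_empty) auto
    then show ?thesis using twice_stirling_alternate_sum_top[of "Suc ?n" k] n True by simp
  next
    case False
    then have k: "k < ?n" using insert.prems n by simp
    interpret one_element_extension B z "relations_mod W ?A x"
    proof
      fix i assume "i \<in> B"
      then show "\<exists>\<gamma>\<in>relations_mod W ?A x. \<gamma> i \<noteq> \<gamma> z"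
        using insert.prems insert.hyps n k by (intro generic_separation[where k = k]) auto
    qed (use insert.hyps relations_mod_combination[OF W] in blast)+
    have restr: "card (orders B {\<beta> \<in> relations_mod W ?A x. \<beta> i = \<beta> z})
        + 2 * stirling_alternate_sum ?n k = fact ?n" if "i \<in> B" for i
    proof -
      have "sum x ?A = sum (x(i := x i + x z)) B"
        using sum_merged[of B z i "\<lambda>_. 1" x] insert.hyps that by simp
      then show ?thesis
        unfolding orders_restriction[OF \<open>finite B\<close> \<open>z \<notin> B\<close> that]
        using insert.prems k generic_restriction[OF insert.prems(3) \<open>finite B\<close> \<open>z \<notin> B\<close> that]
        by (intro insert.IH) (simp_all del: fun_upd_apply)
    qed
    have del: "card (orders B (relations_mod W ?A x)) + 2 * stirling_alternate_sum ?n (k - 1) = fact ?n"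
    proof -
      let ?W = "span (insert (x z) W)"
      have "sum x ?A - x z = sum x B" using insert.hyps by simp
      moreover have "sum x ?A - x z \<in> ?W"
        using insert.prems by (intro span_diff) (auto intro: span_base)
      ultimately have s: "sum x B \<in> ?W" by simp
      \<comment> \<open>At \<open>k = 0\<close> there is no codimension to lower: \<open>W\<close>
        is already the whole space, and the truncated \<open>k - 1\<close> is \<open>0\<close>,
        where the Stirling sum vanishes as required.\<close>
      have "generic ?W B x (k - 1)"
      proof (cases k)
        case 0
        then have "W = UNIV"
          using generic_0_iff[of ?A W x] insert.prems(3) insert.hyps by simp
        then have "span (insert (x z) W) = UNIV" by (simp add: span_UNIV insert_UNIV)
        then show ?thesis
          using 0 insert.hyps by (simp add: generic_0_iff)
      next
        case (Suc l)
        then show ?thesis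
          using generic_deletion[of W z B x l] insert by simp
      qed
      then show ?thesis
        unfolding orders_deletion[OF \<open>finite B\<close> \<open>z \<notin> B\<close> W]
        using s k by (intro insert.IH) auto
    qed
    have "card (orders ?A (relations_mod W ?A x)) + (2 * stirling_alternate_sum ?n (k - 1)
        + ?n * (2 * stirling_alternate_sum ?n k))
      = (card (orders B (relations_mod W ?A x)) + 2 * stirling_alternate_sum ?n (k - 1))
        + (\<Sum>i\<in>B. card (orders B {\<beta> \<in> relations_mod W ?A x. \<beta> i = \<beta> z}) + 2 * stirling_alternate_sum ?n k)"
      unfolding card_orders_insert by (simp add: sum.distrib)
    also have "\<dots> = fact ?n + (\<Sum>i\<in>B. fact ?n)"
      unfolding del using restr by simp
    also have "\<dots> = fact (Suc ?n)" by simp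
    finally show ?thesis
      using stirling_alternate_sum_Suc[OF n(1), of "k - 1"] n
      by (cases k) (simp_all add: stirling_alternate_sum_0 algebra_simps)
  qed
qed

subsection \<open>Walks\<close>

lemma sorting_permutation:
  fixes g :: "nat \<Rightarrow> 'b::linorder"
  shows "\<exists>\<sigma>. \<sigma> permutes {1..n} \<and> (\<forall>i\<in>{1..n}. \<forall>j\<in>{1..n}. i \<le> j \<longrightarrow> g (\<sigma> i) \<le> g (\<sigma> j))"
proof -
  define xs where "xs = sort_key g [1..<Suc n]"
  have xs: "distinct xs" "set xs = {1..n}" "length xs = n" "sorted (map g xs)"
    by (auto simp: xs_def)
  define \<sigma> where "\<sigma> i = (if i \<in> {1..n} then xs ! (i - 1) else i)" for i
  have "bij_betw (\<lambda>i. xs ! (i - 1)) {1..n} {1..n}"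
  proof -
    have "bij_betw (\<lambda>i. i - 1) {1..n} {..<n}"
      by (rule bij_betw_byWitness[where f' = Suc]) auto
    from bij_betw_trans[OF this bij_betw_nth[OF xs(1)]] show ?thesis
      using xs by (simp add: o_def)
  qed
  then have "bij_betw \<sigma> {1..n} {1..n}"
    by (rule bij_betw_cong[THEN iffD1, rotated]) (auto simp: \<sigma>_def)
  then have "\<sigma> permutes {1..n}"
    by (rule bij_imp_permutes) (auto simp: \<sigma>_def)
  moreover have "g (\<sigma> i) \<le> g (\<sigma> j)" if "i \<in> {1..n}" "j \<in> {1..n}" "i \<le> j" for i j
  proof -
    have "map g xs ! (i - 1) \<le> map g xs ! (j - 1)"
      using that xs by (intro sorted_nth_mono) auto
    then show ?thesis using that xs by (auto simp: \<sigma>_def)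
  qed
  ultimately show ?thesis by blast
qed

text \<open>Sorting by the number of members that miss an element puts the elements of each member
  before all others, since a member missing an element of \<open>S\<close> lies inside
  \<open>S\<close>. Ties are harmless.\<close>

lemma chain_prefixes:
  assumes "proper_chain {1..n} C"
  shows "\<exists>\<sigma>. \<sigma> permutes {1..n} \<and> (\<forall>S\<in>C. S = \<sigma> ` {1..card S} \<and> card S \<in> {1..<n})"
proof -
  define g where "g a = card {S \<in> C. a \<notin> S}" for a
  obtain \<sigma> where \<sigma>: "\<sigma> permutes {1..n}"
    and sorted: "\<And>i j. i \<in> {1..n} \<Longrightarrow> j \<in> {1..n} \<Longrightarrow> i \<le> j \<Longrightarrow> g (\<sigma> i) \<le> g (\<sigma> j)"
    using sorting_permutation[of n g] by blast
  have fin: "finite C" using assms proper_chain_finite by blast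
  have "S = \<sigma> ` {1..card S} \<and> card S \<in> {1..<n}" if S: "S \<in> C" for S
  proof -
    have sub: "S \<subset> {1..n}" "S \<noteq> {}" using S assms by (auto simp: proper_chain_def)
    have less: "g a < g b" if "a \<in> S" "b \<notin> S" for a b
      unfolding g_def
    proof (rule psubset_card_mono)
      have "b \<notin> T" if "T \<in> C" "a \<notin> T" for T
        using that S assms \<open>a \<in> S\<close> \<open>b \<notin> S\<close> unfolding proper_chain_def by blast
      then show "{S \<in> C. a \<notin> S} \<subset> {S \<in> C. b \<notin> S}" using S that by blast
    qed (use fin in simp)
    define D where "D = {i \<in> {1..n}. \<sigma> i \<in> S}"
    have "S \<subseteq> \<sigma> ` {1..n}" using sub permutes_image[OF \<sigma>] by simp
    then have img: "\<sigma> ` D = S" unfolding D_def by blast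
    have card: "card D = card S"
      using img card_image[OF permutes_inj_on[OF \<sigma>], of D] by simp
    have down: "i \<in> D" if "j \<in> D" "1 \<le> i" "i \<le> j" for i j
      using that sorted[of i j] less[of "\<sigma> j" "\<sigma> i"] by (force simp: D_def)
    have "D = {1..card D}"
    proof (cases "D = {}")
      case False
      have "finite D" by (simp add: D_def)
      then have max: "Max D \<in> D" "\<And>i. i \<in> D \<Longrightarrow> i \<le> Max D" using False by auto
      have "D = {1..Max D}"
      proof (intro equalityI subsetI)
        fix i assume "i \<in> D"
        then show "i \<in> {1..Max D}" using max(2) by (auto simp: D_def)
      next
        fix i assume "i \<in> {1..Max D}"
        then show "i \<in> D" using down[OF max(1)] by simp
      qed
      then show ?thesis by (metis card_atLeastAtMost diff_Suc_1)
    qed simp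
    moreover have "card S < n" using psubset_card_mono[OF _ sub(1)] by simp
    moreover have "card S > 0" using sub finite_subset[of S "{1..n}"] by (simp add: card_gt_0_iff psubset_imp_subset)
    ultimately show ?thesis using img card by auto
  qed
  then show ?thesis using \<sigma> by blast
qed

text \<open>Each injective \<open>\<beta>\<close> decreases along exactly one permutation, and that
  permutation depends only on the induced order.\<close>

lemma card_orders_eq_card_permutations:
  fixes L :: "(nat \<Rightarrow> real) set"
  shows
  "card (orders {1..n} L)
   = card {\<sigma>. \<sigma> permutes {1..n} \<and> (\<exists>\<beta>\<in>L. \<forall>i\<in>{1..n}. \<forall>j\<in>{1..n}. i < j \<longrightarrow> \<beta> (\<sigma> j) < \<beta> (\<sigma> i))}"
proof -
  define P where "P = {\<sigma>. \<sigma> permutes {1..n} \<and> (\<exists>\<beta>\<in>L. \<forall>i\<in>{1..n}. \<forall>j\<in>{1..n}. i < j \<longrightarrow> \<beta> (\<sigma> j) < \<beta> (\<sigma> i))}"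
  define h where "h \<sigma> = {(\<sigma> j, \<sigma> i) | i j. i \<in> {1..n} \<and> j \<in> {1..n} \<and> i < j}" for \<sigma> :: "nat \<Rightarrow> nat"
  have h: "order_on {1..n} \<beta> = h \<sigma> \<and> inj_on \<beta> {1..n}"
    if \<sigma>: "\<sigma> permutes {1..n}" and dec: "\<And>i j. i \<in> {1..n} \<Longrightarrow> j \<in> {1..n} \<Longrightarrow> i < j \<Longrightarrow> \<beta> (\<sigma> j) < \<beta> (\<sigma> i)"
    for \<sigma> and \<beta> :: "nat \<Rightarrow> real"
  proof -
    have img: "\<sigma> ` {1..n} = {1..n}" using permutes_image[OF \<sigma>] .
    have iff: "\<beta> (\<sigma> j) < \<beta> (\<sigma> i) \<longleftrightarrow> i < j" if "i \<in> {1..n}" "j \<in> {1..n}" for i j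
      using dec[of i j] dec[of j i] that by (cases i j rule: linorder_cases) auto
    have "order_on (\<sigma> ` {1..n}) \<beta> = h \<sigma>"
      unfolding order_on_def h_def using iff by blast
    moreover have "inj_on \<beta> (\<sigma> ` {1..n})"
    proof (rule inj_onI)
      fix a b assume "a \<in> \<sigma> ` {1..n}" "b \<in> \<sigma> ` {1..n}" "\<beta> a = \<beta> b"
      then obtain i j where "i \<in> {1..n}" "j \<in> {1..n}" "a = \<sigma> i" "b = \<sigma> j" "\<beta> (\<sigma> i) = \<beta> (\<sigma> j)"
        by auto
      then show "a = b" using iff[of i j] iff[of j i] by (cases i j rule: linorder_cases) auto
    qed
    ultimately show ?thesis unfolding img by blast
  qed
  have "inj_on h P"
  proof (rule inj_onI)
    fix \<sigma> \<tau> assume "\<sigma> \<in> P" "\<tau> \<in> P" and eq: "h \<sigma> = h \<tau>"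
    then have perm: "\<sigma> permutes {1..n}" "\<tau> permutes {1..n}" by (auto simp: P_def)
    \<comment> \<open>Exactly \<open>n - i\<close> elements lie below \<open>\<rho> i\<close>, so
      the order determines the place of each element.\<close>
    have rank: "card {a. (a, \<rho> i) \<in> h \<rho>} = n - i" if "\<rho> permutes {1..n}" "i \<in> {1..n}" for \<rho> i
    proof -
      have "\<rho> k = \<rho> l \<longleftrightarrow> k = l" for k l using permutes_inj[OF that(1)] by (auto dest: injD)
      then have "(a, \<rho> i) \<in> h \<rho> \<longleftrightarrow> (\<exists>j\<in>{i<..n}. a = \<rho> j)" for a
        unfolding h_def using that(2) by force
      then have "{a. (a, \<rho> i) \<in> h \<rho>} = \<rho> ` {i<..n}" by blast
      then show ?thesis by (simp add: card_image permutes_inj_on[OF that(1)])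
    qed
    show "\<sigma> = \<tau>"
    proof
      fix i show "\<sigma> i = \<tau> i"
      proof (cases "i \<in> {1..n}")
        case True
        then have "\<sigma> i \<in> \<tau> ` {1..n}"
          using permutes_image[OF perm(2)] permutes_in_image[OF perm(1)] by auto
        then obtain j where j: "j \<in> {1..n}" "\<sigma> i = \<tau> j" by auto
        have "n - i = n - j"
          using rank[OF perm(1) True] rank[OF perm(2) j(1)] j(2) eq by simp
        then show ?thesis using True j by (metis atLeastAtMost_iff diff_diff_cancel)
      qed (use perm in \<open>auto simp: permutes_not_in\<close>)
    qed
  qed
  moreover have "h ` P = orders {1..n} L"
  proof (intro equalityI subsetI)
    fix r assume "r \<in> h ` P"
    then obtain \<sigma> \<beta> where "\<sigma> permutes {1..n}" "\<beta> \<in> L" "r = h \<sigma>"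
      "\<And>i j. i \<in> {1..n} \<Longrightarrow> j \<in> {1..n} \<Longrightarrow> i < j \<Longrightarrow> \<beta> (\<sigma> j) < \<beta> (\<sigma> i)"
      unfolding P_def by blast
    then show "r \<in> orders {1..n} L" using h[of \<sigma> \<beta>] unfolding orders_def by blast
  next
    fix r assume "r \<in> orders {1..n} L"
    then obtain \<beta> where \<beta>: "\<beta> \<in> L" "inj_on \<beta> {1..n}" "r = order_on {1..n} \<beta>"
      by (auto simp: orders_def)
    obtain \<sigma> where \<sigma>: "\<sigma> permutes {1..n}"
      and sorted: "\<And>i j. i \<in> {1..n} \<Longrightarrow> j \<in> {1..n} \<Longrightarrow> i \<le> j \<Longrightarrow> - \<beta> (\<sigma> i) \<le> - \<beta> (\<sigma> j)"
      using sorting_permutation[of n "\<lambda>a. - \<beta> a"] by blast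
    have dec: "\<beta> (\<sigma> j) < \<beta> (\<sigma> i)" if ij: "i \<in> {1..n}" "j \<in> {1..n}" "i < j" for i j
    proof -
      have "\<sigma> i \<noteq> \<sigma> j" using permutes_inj[OF \<sigma>] ij by (auto dest: injD)
      then have "\<beta> (\<sigma> i) \<noteq> \<beta> (\<sigma> j)"
        using \<beta>(2) ij permutes_in_image[OF \<sigma>] by (metis inj_onD)
      then show ?thesis using sorted[of i j] ij by simp
    qed
    then have "\<sigma> \<in> P" using \<sigma> \<beta>(1) unfolding P_def by blast
    then show "r \<in> h ` P" using h[of \<sigma> \<beta>, OF \<sigma> dec] \<beta>(3) by blast
  qed
  ultimately show ?thesis unfolding P_def[symmetric] by (metis card_image)
qed

section \<open>Abel summation and linear relations\<close>

lemma sum_tails: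
  fixes t :: "nat \<Rightarrow> real" and y :: "nat \<Rightarrow> 'v::real_vector"
  shows "(\<Sum>j\<in>{1..n}. (\<Sum>i\<in>{j..<n}. t i) *\<^sub>R y j) = (\<Sum>i\<in>{1..<n}. t i *\<^sub>R (\<Sum>j\<in>{1..i}. y j))"
proof -
  \<comment> \<open>The tail at \<open>j = n\<close> is empty, so \<open>y n\<close> enters neither
    side.\<close>
  have "(\<Sum>j\<in>{1..n}. (\<Sum>i\<in>{j..<n}. t i) *\<^sub>R y j)
      = (\<Sum>j\<in>{1..n}. \<Sum>i | i \<in> {1..<n} \<and> j \<le> i. t i *\<^sub>R y j)"
    unfolding scaleR_sum_left by (intro sum.cong) auto
  also have "\<dots> = (\<Sum>i\<in>{1..<n}. \<Sum>j | j \<in> {1..n} \<and> j \<le> i. t i *\<^sub>R y j)"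
    by (rule sum.swap_restrict) auto
  also have "\<dots> = (\<Sum>i\<in>{1..<n}. t i *\<^sub>R (\<Sum>j\<in>{1..i}. y j))"
    unfolding scaleR_sum_right by (intro sum.cong) auto
  finally show ?thesis .
qed

text \<open>As the vectors of positive weight span, they express minus the sum of the remaining
  ones: this is a relation \<open>d\<close> with coefficient \<open>1\<close> wherever
  \<open>t\<close> vanishes. A small multiple of it, added to \<open>t\<close>, makes all
  coefficients positive.\<close>

lemma positive_relation_of_nonnegative:
  fixes s :: "'i \<Rightarrow> 'v::real_vector"
  assumes "finite I" "\<And>i. i \<in> I \<Longrightarrow> t i \<ge> (0::real)" "(\<Sum>i\<in>I. t i *\<^sub>R s i) = 0"
    and span: "\<And>v. \<exists>c. v = (\<Sum>i\<in>{i \<in> I. t i > 0}. c i *\<^sub>R s i)"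
  shows "\<exists>u. (\<forall>i\<in>I. u i > 0) \<and> (\<Sum>i\<in>I. u i *\<^sub>R s i) = 0"
proof -
  let ?J = "{i \<in> I. t i > 0}"
  obtain c where c: "- (\<Sum>i\<in>I - ?J. s i) = (\<Sum>i\<in>?J. c i *\<^sub>R s i)" using span by blast
  define d where "d i = (if i \<in> ?J then c i else 1)" for i
  have "(\<Sum>i\<in>I. d i *\<^sub>R s i) = (\<Sum>i\<in>?J. d i *\<^sub>R s i) + (\<Sum>i\<in>I - ?J. d i *\<^sub>R s i)"
    using assms(1) by (subst sum.subset_diff[of ?J]) (auto simp: add.commute)
  also have "(\<Sum>i\<in>?J. d i *\<^sub>R s i) = (\<Sum>i\<in>?J. c i *\<^sub>R s i)"
    by (rule sum.cong) (auto simp: d_def)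
  also have "(\<Sum>i\<in>I - ?J. d i *\<^sub>R s i) = (\<Sum>i\<in>I - ?J. s i)"
    by (rule sum.cong) (auto simp: d_def)
  finally have d: "(\<Sum>i\<in>I. d i *\<^sub>R s i) = 0" unfolding c[symmetric] by simp
  have "eventually (\<lambda>\<epsilon>. \<forall>i\<in>?J. t i + \<epsilon> * d i > 0) (at_right 0)"
  proof (intro eventually_ball_finite ballI)
    fix i assume "i \<in> ?J"
    have "((\<lambda>\<epsilon>. t i + \<epsilon> * d i) \<longlongrightarrow> t i + 0 * d i) (at_right 0)" by (intro tendsto_intros)
    then show "eventually (\<lambda>\<epsilon>. t i + \<epsilon> * d i > 0) (at_right 0)"
      by (rule order_tendstoD) (use \<open>i \<in> ?J\<close> in auto)
  qed (use assms in auto)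
  then have "eventually (\<lambda>\<epsilon>. \<epsilon> > 0 \<and> (\<forall>i\<in>?J. t i + \<epsilon> * d i > 0)) (at_right 0)"
    using eventually_at_right_less[of "0::real"] by eventually_elim auto
  then obtain \<epsilon> where \<epsilon>: "\<epsilon> > 0" "\<And>i. i \<in> ?J \<Longrightarrow> t i + \<epsilon> * d i > 0"
    using eventually_happens' trivial_limit_at_right_real by blast
  have "t i + \<epsilon> * d i > 0" if "i \<in> I" for i
  proof (cases "i \<in> ?J")
    case False
    then have "t i = 0" "d i = 1" using that assms(2)[OF that] by (auto simp: d_def)
    then show ?thesis using \<epsilon>(1) by simp
  qed (use \<epsilon> in auto)
  moreover have "(\<Sum>i\<in>I. (t i + \<epsilon> * d i) *\<^sub>R s i)
      = (\<Sum>i\<in>I. t i *\<^sub>R s i) + \<epsilon> *\<^sub>R (\<Sum>i\<in>I. d i *\<^sub>R s i)"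
    by (simp add: scaleR_left_distrib sum.distrib scaleR_sum_right)
  then have "(\<Sum>i\<in>I. (t i + \<epsilon> * d i) *\<^sub>R s i) = 0" using d assms(3) by simp
  ultimately show ?thesis by (intro exI[of _ "\<lambda>i. t i + \<epsilon> * d i"] conjI ballI)
qed

lemma independent_family_spans:
  fixes s :: "'i \<Rightarrow> 'v::euclidean_space"
  assumes "finite I" "card I = DIM('v)" "\<not> dependent_family I s"
  shows "\<exists>c. v = (\<Sum>i\<in>I. c i *\<^sub>R s i)"
proof -
  have ind: "\<And>c i. (\<Sum>i\<in>I. c i *\<^sub>R s i) = 0 \<Longrightarrow> i \<in> I \<Longrightarrow> c i = 0"
    using assms(3) unfolding dependent_family_def by blast
  have inj: "inj_on s I"
  proof (rule inj_onI, rule ccontr)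
    fix i j assume ij: "i \<in> I" "j \<in> I" "s i = s j" "i \<noteq> j"
    let ?c = "\<lambda>k. of_bool (k = i) - of_bool (k = j) :: real"
    have "?c k *\<^sub>R s k = (if k = i then s k else 0) - (if k = j then s k else 0)" for k
      by simp
    then have "(\<Sum>k\<in>I. ?c k *\<^sub>R s k) = (\<Sum>k\<in>I. if k = i then s k else 0) - (\<Sum>k\<in>I. if k = j then s k else 0)"
      by (simp only: sum_subtractf)
    then have "(\<Sum>k\<in>I. ?c k *\<^sub>R s k) = 0" using ij assms(1) by simp
    from ind[OF this ij(1)] show False using ij(4) by simp
  qed
  have "independent (s ` I)"
  proof (rule independent_if_scalars_zero)
    fix f x assume *: "(\<Sum>x\<in>s ` I. f x *\<^sub>R x) = 0" "x \<in> s ` I"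
    then show "f x = 0" using ind[of "\<lambda>i. f (s i)"] by (auto simp: sum.reindex[OF inj])
  qed (use assms in simp)
  moreover have "card (s ` I) = DIM('v)" using assms card_image[OF inj] by simp
  ultimately have "UNIV \<subseteq> span (s ` I)"
    by (intro card_ge_dim_independent) (auto simp: dim_UNIV)
  then have "v \<in> range (\<lambda>u. \<Sum>x\<in>s ` I. u x *\<^sub>R x)"
    using span_finite[of "s ` I"] assms(1) by auto
  then obtain u where "v = (\<Sum>x\<in>s ` I. u x *\<^sub>R x)" by blast
  then have "v = (\<Sum>i\<in>I. u (s i) *\<^sub>R s i)" by (simp add: sum.reindex[OF inj])
  then show ?thesis by (intro exI[of _ "\<lambda>i. u (s i)"])
qed

lemma dependent_family_if_relation:
  "(\<Sum>i\<in>I. c i *\<^sub>R v i) = 0 \<Longrightarrow> i \<in> I \<Longrightarrow> c i \<noteq> 0 \<Longrightarrow> dependent_family I v"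
  unfolding dependent_family_def by blast

section \<open>Bridges, regularity and genericity\<close>

lemma partial_sum_perm_act:
  assumes "\<sigma> permutes {1..n}"
  shows "partial_sum (perm_act n \<sigma> X) i = sum (bridge_increments n X) (\<sigma> ` {1..i})"
  unfolding partial_sum_def perm_act_def
  by (simp add: sum.reindex permutes_inj_on[OF assms])

lemma sum_bridge_increments: "n \<ge> 1 \<Longrightarrow> sum (bridge_increments n X) {1..n} = 0"
proof -
  assume "n \<ge> 1"
  then have "{1..n} = insert n {1..<n}" by auto
  moreover have "sum (bridge_increments n X) {1..<n} = sum X {1..<n}"
    by (rule sum.cong) (auto simp: bridge_increments_def)
  ultimately show ?thesis by (simp add: bridge_increments_def)
qed

lemma regular_independent:
  fixes X :: "nat \<Rightarrow> real ^ 'd"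
  assumes "regular n X" "\<sigma> permutes {1..n}" "I \<subseteq> {1..<n}" "card I = CARD('d)"
  shows "\<not> dependent_family I (partial_sum (perm_act n \<sigma> X))"
  using assms by (auto simp: regular_def wall_def)

text \<open>The members of a chain are prefixes of one permutation, so their sums are partial sums
  of the permuted walk, indexed by the sizes of the members. Regularity applies to this set of
  \<open>CARD('d)\<close> sizes: it gives independence and, by dimension, spanning.\<close>

lemma regular_imp_generic:
  fixes X :: "nat \<Rightarrow> real ^ 'd"
  assumes "regular n X"
  shows "generic {0} {1..n} (bridge_increments n X) CARD('d)"
  unfolding generic_def
proof (intro allI impI)
  fix C :: "nat set set" assume C: "proper_chain {1..n} C \<and> card C = CARD('d)"
  let ?x = "bridge_increments n X"
  obtain \<sigma> where \<sigma>: "\<sigma> permutes {1..n}"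
    and "\<forall>S\<in>C. S = \<sigma> ` {1..card S} \<and> card S \<in> {1..<n}"
    using chain_prefixes[of n C] C by blast
  then have prefix: "S = \<sigma> ` {1..card S}" "card S \<in> {1..<n}" if "S \<in> C" for S
    using that by blast+
  have inj: "inj_on card C"
    by (rule inj_on_inverseI[where g = "\<lambda>k. \<sigma> ` {1..k}"]) (rule prefix(1)[symmetric])
  let ?s = "partial_sum (perm_act n \<sigma> X)"
  have ind: "\<not> dependent_family (card ` C) ?s"
    using prefix(2) C card_image[OF inj] by (intro regular_independent[OF assms \<sigma>]) auto
  have s: "?s (card S) = sum ?x S" if "S \<in> C" for S
    by (simp only: partial_sum_perm_act[OF \<sigma>] prefix(1)[OF that, symmetric])
  have sum: "(\<Sum>i\<in>card ` C. c i *\<^sub>R ?s i) = (\<Sum>S\<in>C. c (card S) *\<^sub>R sum ?x S)" for c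
    by (simp add: sum.reindex[OF inj] s)
  show "(\<forall>c. (\<Sum>S\<in>C. c S *\<^sub>R sum ?x S) \<in> {0} \<longrightarrow> (\<forall>S\<in>C. c S = 0)) \<and>
    (\<forall>v. \<exists>c. v - (\<Sum>S\<in>C. c S *\<^sub>R sum ?x S) \<in> {0})"
  proof (intro conjI allI impI ballI)
    fix c S assume c: "(\<Sum>S\<in>C. c S *\<^sub>R sum ?x S) \<in> {0}" and S: "S \<in> C"
    define c' where "c' i = c (\<sigma> ` {1..i})" for i
    have c': "c' (card S) = c S" if "S \<in> C" for S
      by (simp only: c'_def prefix(1)[OF that, symmetric])
    have "(\<Sum>i\<in>card ` C. c' i *\<^sub>R ?s i) = 0"
      unfolding sum using c by (simp add: c')
    from dependent_family_if_relation[OF this, of "card S"] have "c' (card S) = 0"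
      using ind S by blast
    then show "c S = 0" using c'[OF S] by simp
  next
    fix v
    have "finite C" using C proper_chain_finite by blast
    then obtain c where "v = (\<Sum>i\<in>card ` C. c i *\<^sub>R ?s i)"
      using independent_family_spans[OF _ _ ind, of v] C card_image[OF inj] by auto
    then show "\<exists>c. v - (\<Sum>S\<in>C. c S *\<^sub>R sum ?x S) \<in> {0}"
      unfolding sum by auto
  qed
qed

lemma zero_in_convex_hull_image:
  fixes s :: "'i \<Rightarrow> 'v::real_vector"
  assumes "finite I"
  shows "0 \<in> convex hull (s ` I) \<longleftrightarrow>
    (\<exists>t. (\<forall>i\<in>I. t i \<ge> 0) \<and> (\<exists>i\<in>I. t i > 0) \<and> (\<Sum>i\<in>I. t i *\<^sub>R s i) = 0)" (is "?l \<longleftrightarrow> ?r")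
proof
  assume ?l
  then obtain u where u: "\<And>x. x \<in> s ` I \<Longrightarrow> u x \<ge> 0" "sum u (s ` I) = 1" "(\<Sum>x\<in>s ` I. u x *\<^sub>R x) = 0"
    using assms by (auto simp: convex_hull_finite)
  \<comment> \<open>\<open>s\<close> may repeat points: \<open>J\<close> selects one index per
    point, and the other indices get weight \<open>0\<close>.\<close>
  obtain J where J: "J \<subseteq> I" "inj_on s J" "s ` I = s ` J"
    using subset_image_inj[of "s ` I" s I] by blast
  have sum: "sum (\<lambda>i. u (s i)) J = 1" "(\<Sum>i\<in>J. u (s i) *\<^sub>R s i) = 0"
    using u(2,3) unfolding J(3) by (simp_all add: sum.reindex[OF J(2)])
  define t where "t i = (if i \<in> J then u (s i) else 0)" for i
  have "(\<Sum>i\<in>I. t i *\<^sub>R s i) = (\<Sum>i\<in>J. t i *\<^sub>R s i)"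
    using J assms by (intro sum.mono_neutral_right) (auto simp: t_def)
  then have "(\<Sum>i\<in>I. t i *\<^sub>R s i) = 0" using sum(2) by (simp add: t_def)
  moreover have nn: "\<forall>i\<in>I. t i \<ge> 0" using u(1) by (auto simp: t_def)
  moreover have "\<exists>i\<in>I. t i > 0"
  proof (rule ccontr)
    assume "\<not> ?thesis"
    then have "u (s i) \<le> 0" if "i \<in> J" for i using that J(1) by (force simp: t_def)
    then have "sum (\<lambda>i. u (s i)) J \<le> 0" by (rule sum_nonpos)
    then show False using sum(1) by simp
  qed
  ultimately show ?r by blast
next
  assume ?r
  then obtain t where t: "\<And>i. i \<in> I \<Longrightarrow> t i \<ge> 0" "\<exists>i\<in>I. t i > 0" "(\<Sum>i\<in>I. t i *\<^sub>R s i) = 0" by blast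
  from t(2) obtain i where "i \<in> I" "t i > 0" by blast
  then have pos: "sum t I > 0" using sum_pos2[OF assms, of i t] t(1) by blast
  have "(\<Sum>i\<in>I. (t i / sum t I) *\<^sub>R s i) \<in> convex hull (s ` I)"
    using t(1) pos assms
    by (intro convex_sum convex_convex_hull) (auto simp: hull_inc less_imp_le sum_divide_distrib[symmetric])
  also have "(\<Sum>i\<in>I. (t i / sum t I) *\<^sub>R s i) = (1 / sum t I) *\<^sub>R (\<Sum>i\<in>I. t i *\<^sub>R s i)"
    by (simp add: scaleR_sum_right)
  finally show ?l using t(3) by simp
qed

lemma zero_in_walk_hull_iff:
  fixes X :: "nat \<Rightarrow> real ^ 'd"
  assumes "n \<ge> 2" "regular n X" "CARD('d) < n" and \<sigma>: "\<sigma> permutes {1..n}"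
  shows "0 \<in> walk_hull n (perm_act n \<sigma> X) \<longleftrightarrow>
    (\<exists>\<beta>\<in>relations_mod {0} {1..n} (bridge_increments n X).
      \<forall>i\<in>{1..n}. \<forall>j\<in>{1..n}. i < j \<longrightarrow> \<beta> (\<sigma> j) < \<beta> (\<sigma> i))" (is "_ \<longleftrightarrow> ?r")
proof -
  let ?y = "perm_act n \<sigma> X" and ?x = "bridge_increments n X"
  let ?s = "partial_sum ?y"
  have rel: "\<beta> \<in> relations_mod {0} {1..n} ?x \<longleftrightarrow> (\<Sum>j\<in>{1..n}. \<beta> (\<sigma> j) *\<^sub>R ?y j) = 0" for \<beta>
  proof -
    have "(\<Sum>a\<in>{1..n}. \<beta> a *\<^sub>R ?x a) = (\<Sum>j\<in>{1..n}. \<beta> (\<sigma> j) *\<^sub>R ?y j)"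
      using sum.permute[OF \<sigma>, of "\<lambda>a. \<beta> a *\<^sub>R ?x a"] by (simp add: o_def perm_act_def)
    then show ?thesis by (simp add: relations_mod_def)
  qed
  have y0: "(\<Sum>j\<in>{1..n}. ?y j) = 0"
    using sum.permute[OF \<sigma>, of ?x] sum_bridge_increments[of n X] assms(1)
    by (simp add: o_def perm_act_def)
  have tails: "(\<Sum>j\<in>{1..n}. (\<Sum>i\<in>{j..<n}. t i) *\<^sub>R ?y j) = (\<Sum>i\<in>{1..<n}. t i *\<^sub>R ?s i)" for t
    unfolding partial_sum_def by (rule sum_tails)
  show ?thesis
  proof
    assume "0 \<in> walk_hull n ?y"
    then obtain t where t: "\<And>i. i \<in> {1..<n} \<Longrightarrow> t i \<ge> 0" "\<exists>i\<in>{1..<n}. t i > 0"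
      "(\<Sum>i\<in>{1..<n}. t i *\<^sub>R ?s i) = 0"
      unfolding walk_hull_def zero_in_convex_hull_image[OF finite_atLeastLessThan] by blast
    let ?J = "{i \<in> {1..<n}. t i > 0}"
    \<comment> \<open>If fewer than \<open>CARD('d)\<close> coefficients were positive, the relation
      would violate independence on a set of \<open>CARD('d)\<close> indices containing its support.
      So the support contains an independent set of that size, which spans.\<close>
    have span: "\<exists>c. v = (\<Sum>i\<in>?J. c i *\<^sub>R ?s i)" for v
    proof -
      have "\<not> card ?J < CARD('d)"
      proof
        assume "card ?J < CARD('d)"
        then have "\<exists>I. ?J \<subseteq> I \<and> I \<subseteq> {1..<n} \<and> card I = CARD('d)"
          using assms(3) by (intro exists_subset_between) auto
        then obtain I where I: "?J \<subseteq> I" "I \<subseteq> {1..<n}" "card I = CARD('d)" by blast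
        have "t i = 0" if "i \<in> {1..<n} - I" for i
        proof -
          have "i \<notin> ?J" "i \<in> {1..<n}" using that I(1) by blast+
          then show ?thesis using t(1)[of i] by simp
        qed
        then have sumI: "(\<Sum>i\<in>I. t i *\<^sub>R ?s i) = 0"
          using I(2) unfolding t(3)[symmetric] by (intro sum.mono_neutral_left) auto
        obtain i where i: "i \<in> {1..<n}" "t i > 0" using t(2) by blast
        then have "i \<in> I" using I(1) by blast
        then have "dependent_family I ?s"
          using dependent_family_if_relation[OF sumI] i(2) by simp
        then show False using regular_independent[OF assms(2) \<sigma> I(2,3)] by simp
      qed
      then have "CARD('d) \<le> card ?J" by (rule leI)
      then obtain I where I: "I \<subseteq> ?J" "card I = CARD('d)" "finite I"
        by (rule obtain_subset_with_card_n)
      then have "I \<subseteq> {1..<n}" by blast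
      from regular_independent[OF assms(2) \<sigma> this I(2)] have "\<not> dependent_family I ?s" .
      then obtain c where "v = (\<Sum>i\<in>I. c i *\<^sub>R ?s i)"
        using independent_family_spans[of I ?s v] I by auto
      also have "\<dots> = (\<Sum>i\<in>I. (if i \<in> I then c i else 0) *\<^sub>R ?s i)" by (rule sum.cong) auto
      also have "\<dots> = (\<Sum>i\<in>?J. (if i \<in> I then c i else 0) *\<^sub>R ?s i)"
        using I(1) by (intro sum.mono_neutral_left) auto
      finally show ?thesis by (rule exI[of _ "\<lambda>i. if i \<in> I then c i else 0"])
    qed
    obtain u where u: "\<And>i. i \<in> {1..<n} \<Longrightarrow> u i > 0" "(\<Sum>i\<in>{1..<n}. u i *\<^sub>R ?s i) = 0"
      using positive_relation_of_nonnegative[OF finite_atLeastLessThan t(1,3) span] by blast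
    \<comment> \<open>The tail sums of \<open>u\<close>, read along \<open>\<sigma>\<close>;
      positivity of \<open>u\<close> makes them strictly decreasing.\<close>
    define \<beta> where "\<beta> a = (\<Sum>i\<in>{inv \<sigma> a..<n}. u i)" for a
    have \<beta>: "\<beta> (\<sigma> j) = (\<Sum>i\<in>{j..<n}. u i)" for j
      by (simp add: \<beta>_def permutes_inverses[OF \<sigma>])
    have "\<beta> \<in> relations_mod {0} {1..n} ?x"
      unfolding rel \<beta> tails by (rule u(2))
    moreover have "\<beta> (\<sigma> j) < \<beta> (\<sigma> i)" if "i \<in> {1..n}" "j \<in> {1..n}" "i < j" for i j
      unfolding \<beta>
    proof (rule sum_strict_mono2[where b = i])
      show "0 \<le> u k" if "k \<in> {i..<n}" for k
        using u(1)[of k] that \<open>i \<in> {1..n}\<close> by auto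
    qed (use that u(1)[of i] in auto)
    ultimately show ?r by blast
  next
    assume ?r
    then obtain \<beta> where \<beta>: "(\<Sum>j\<in>{1..n}. \<beta> (\<sigma> j) *\<^sub>R ?y j) = 0"
      and dec: "\<And>i j. i \<in> {1..n} \<Longrightarrow> j \<in> {1..n} \<Longrightarrow> i < j \<Longrightarrow> \<beta> (\<sigma> j) < \<beta> (\<sigma> i)"
      unfolding rel[symmetric] by blast
    \<comment> \<open>Inverse to the tail sums: consecutive differences recover
      \<open>\<beta>\<close> up to the constant \<open>\<beta> (\<sigma> n)\<close>, which drops out
      because the increments of a bridge sum to \<open>0\<close>.\<close>
    define t where "t i = \<beta> (\<sigma> i) - \<beta> (\<sigma> (Suc i))" for i
    have t: "t i > 0" if "i \<in> {1..<n}" for i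
      using dec[of i "Suc i"] that by (simp add: t_def)
    have "(\<Sum>i\<in>{j..<n}. t i) = \<beta> (\<sigma> j) - \<beta> (\<sigma> n)" if "j \<in> {1..n}" for j
      using that sum_Suc_diff'[of j n "\<lambda>i. - \<beta> (\<sigma> i)"] by (simp add: t_def)
    then have "(\<Sum>i\<in>{1..<n}. t i *\<^sub>R ?s i) = (\<Sum>j\<in>{1..n}. (\<beta> (\<sigma> j) - \<beta> (\<sigma> n)) *\<^sub>R ?y j)"
      unfolding tails[symmetric] by (intro sum.cong) auto
    also have "\<dots> = (\<Sum>j\<in>{1..n}. \<beta> (\<sigma> j) *\<^sub>R ?y j) - \<beta> (\<sigma> n) *\<^sub>R (\<Sum>j\<in>{1..n}. ?y j)"
      by (simp only: scaleR_left_diff_distrib sum_subtractf scaleR_sum_right)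
    finally have "(\<Sum>i\<in>{1..<n}. t i *\<^sub>R ?s i) = 0" using \<beta> y0 by simp
    moreover have "1 \<in> {1..<n}" using assms(1) by auto
    ultimately have "\<exists>t. (\<forall>i\<in>{1..<n}. t i \<ge> 0) \<and> (\<exists>i\<in>{1..<n}. t i > 0) \<and> (\<Sum>i\<in>{1..<n}. t i *\<^sub>R ?s i) = 0"
      using t by (intro exI[of _ t]) (auto intro: less_imp_le)
    then show "0 \<in> walk_hull n ?y"
      unfolding walk_hull_def zero_in_convex_hull_image[OF finite_atLeastLessThan] .
  qed
qed

theorem theorem16:
  fixes X :: "nat \<Rightarrow> real ^ 'd" and n :: nat
  assumes "n \<ge> CARD('d) + 2"
    and "regular n X"
  shows "card {\<sigma>. \<sigma> permutes {1..n} \<and> 0 \<notin> walk_hull n (perm_act n \<sigma> X)}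
       = 2 * (\<Sum>r. stirling_int n (int CARD('d) - 2 * int r))"
proof -
  let ?L = "relations_mod {0} {1..n} (bridge_increments n X)"
  let ?in = "{\<sigma>. \<sigma> permutes {1..n} \<and> 0 \<in> walk_hull n (perm_act n \<sigma> X)}"
  let ?out = "{\<sigma>. \<sigma> permutes {1..n} \<and> 0 \<notin> walk_hull n (perm_act n \<sigma> X)}"
  have fin: "finite {\<sigma>. \<sigma> permutes {1..n}}" by (rule finite_permutations) simp
  \<comment> \<open>Hulls containing \<open>0\<close> are counted by the orderings of the relation
    space, with \<open>W = {0}\<close> and codimension \<open>CARD('d)\<close>; the claim concerns
    the complement among all \<open>fact n\<close> permutations.\<close>
  have "card ?in = card (orders {1..n} ?L)"
    unfolding card_orders_eq_card_permutations
    using assms by (intro arg_cong[of _ _ card] Collect_cong conj_cong refl zero_in_walk_hull_iff) auto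
  then have "card ?in + 2 * stirling_alternate_sum n CARD('d) = fact n"
    using card_orders_generic[of "{1..n}" "{0}" "bridge_increments n X" "CARD('d)"] assms
      regular_imp_generic[OF assms(2)] sum_bridge_increments[of n X] by simp
  moreover have "card ?in + card ?out = card (?in \<union> ?out)"
    by (rule card_Un_disjoint[symmetric]) (auto intro: finite_subset[OF _ fin])
  moreover have "?in \<union> ?out = {\<sigma>. \<sigma> permutes {1..n}}" by blast
  moreover have "card {\<sigma>. \<sigma> permutes {1..n}} = fact n"
    by (rule card_permutations) simp_all
  ultimately show ?thesis by (simp add: suminf_stirling_int_eq)
qed

end
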